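(* Let $0<p<1$ and let $\alpha\ge 0$. (a) Let $f\in H_p^{\square}(G_m^2)$ be such that $$\omega_{H_p^{\square}(G_m^2)}\left(\frac{1}{M_k},f\right)=o\left(\frac{1}{M_k^{2/p-2}}\right)\quad\text{as } k\to\infty .$$ Then $$\left\Vert S_{m,n}f-f\right\Vert_{H_p^{\square}(G_m^2)}\to 0\quad\text{as } m,n\to\infty \text{ with } 2^{-\alpha}\le m/n\le 2^{\alpha}.$$ (b) (Sharpness) There exists a martingale $f\in H_p^{\square}(G_m^2)$ such that $$\omega_{H_p^{\square}(G_m^2)}\left(\frac{1}{M_k},f\right)=O\left(\frac{1}{M_k^{2/p-2}}\right)\quad\text{as } k\to\infty$$ and $\left\Vert S_{m,n}f-f\right\Vert_{weak\text{-}L_p(G_m^2)}$ does not converge to $0$ as $m,n\to\infty$ with $2^{-\alpha}\le m/n\le 2^{\alpha}$.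
   Context: $\mathbb N=\{0,1,2,\dots\}$. Let $(m_k)_{k\in\mathbb N}$ be a bounded sequence of integers $m_k\ge 2$, fixed throughout. $G_m=\prod_{k=0}^\infty Z_{m_k}$ is the corresponding (bounded) Vilenkin group, where $Z_{m_k}=\{0,\dots,m_k-1\}$ is the additive group of integers modulo $m_k$, with the product of the discrete topologies; $\mu$ is its normalized Haar measure (the product of the uniform measures on the $Z_{m_k}$). The subscript in $G_m$ only refers to this sequence and is unrelated to the integer index $m$ in $S_{m,n}$. Put $M_0=1$, $M_{k+1}=m_kM_k$. For $x=(x_0,x_1,\dots)\in G_m$ put $I_0(x)=G_m$ and $I_n(x)=\{y\in G_m: y_0=x_0,\dots,y_{n-1}=x_{n-1}\}$. Every $n\in\mathbb N$ is uniquely $n=\sum_{j\ge 0} n_jM_j$ with $n_j\in Z_{m_j}$. With $r_k(x)=\exp(2\pi i x_k/m_k)$, the Vilenkin functions are $\psi_n(x)=\prod_{k\ge0} r_k^{n_k}(x)$. Let $\mathcal F_{n,n}$ be the $\sigma$-algebra on $G_m^2$ generated by the squares $I_n(x)\times I_n(y)$, $x,y\in G_m$. Martingales $f=(f_{n,n})_{n\in\mathbb N}$ are with respect to $(\mathcal F_{n,n})_{n\in\mathbb N}$. Let $f^*=\sup_n|f_{n,n}|$. For $0<p<\infty$, $H_p^{\square}(G_m^2)$ is the space of all martingales with $\Vert f\Vert_{H_p^\square(G_m^2)}:=\Vert f^*\Vert_p<\infty$, where $\Vert g\Vert_p=(\int_{G_m^2}|g|^p\,d(\mu\times\mu))^{1/p}$.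 Also $\Vert g\Vert_{weak\text{-}L_p(G_m^2)}=\sup_{\lambda>0}\lambda\,(\mu\times\mu)(|g|>\lambda)^{1/p}$. For a martingale $f$, its Vilenkin-Fourier coefficients are $\widehat f(i,j)=\lim_{k\to\infty}\int_{G_m^2} f_{k,k}(x,y)\overline{\psi_i(x)}\,\overline{\psi_j(y)}\,d\mu(x)d\mu(y)$, and the rectangular partial sums are $S_{m,n}f(x,y)=\sum_{i=0}^{m-1}\sum_{j=0}^{n-1}\widehat f(i,j)\psi_i(x)\psi_j(y)$. An integrable function $g$ (e.g. $S_{m,n}f$) is identified with the martingale $(S_{M_k,M_k}g)_{k\in\mathbb N}$. The modulus of continuity is $$\omega_{H_p^\square(G_m^2)}\left(\frac1{M_k},f\right):=\Vert f-S_{M_k,M_k}f\Vert_{H_p^\square(G_m^2)}.$$ In the expression $\Vert S_{m,n}f-f\Vert_{weak\text{-}L_p}$ the symbol $f$ denotes the a.e. limit $\lim_{n\to\infty}f_{n,n}$, which exists for $f\in H_p^\square(G_m^2)$. *)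

theory Defs
  imports "HOL-Probability.Probability" "HOL-Library.Landau_Symbols"
begin

subsection \<open>The Vilenkin group and the Vilenkin system\<close>

text \<open>
  A sequence \<open>m\<close> of naturals determines the group \<open>\<Prod>k. {0..<m k}\<close>; as a
  measure space it is the product of the uniform probability measures on the factors, which is
  the normalized Haar measure. Only the measure-theoretic structure is used below. All functions
  on the group are total functions on \<^typ>\<open>nat \<Rightarrow> nat\<close>; their values off the carrier
  are irrelevant.
\<close>

definition vilenkin_measure :: "(nat \<Rightarrow> nat) \<Rightarrow> (nat \<Rightarrow> nat) measure" where
  "vilenkin_measure m = PiM UNIV (\<lambda>k. uniform_count_measure {..<m k})"

definition vilenkin_measure2 :: "(nat \<Rightarrow> nat) \<Rightarrow> ((nat \<Rightarrow> nat) \<times> (nat \<Rightarrow> nat)) measure" where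
  "vilenkin_measure2 m = vilenkin_measure m \<Otimes>\<^sub>M vilenkin_measure m"

lemma space_vilenkin_measure: "space (vilenkin_measure m) = {x. \<forall>k. x k < m k}"
  by (auto simp: vilenkin_measure_def space_PiM space_uniform_count_measure PiE_def Pi_def)

definition vilenkin_M :: "(nat \<Rightarrow> nat) \<Rightarrow> nat \<Rightarrow> nat" where
  "vilenkin_M m k = (\<Prod>j<k. m j)"

definition vilenkin_cyl :: "(nat \<Rightarrow> nat) \<Rightarrow> nat \<Rightarrow> (nat \<Rightarrow> nat) \<Rightarrow> (nat \<Rightarrow> nat) set" where
  "vilenkin_cyl m n x = {y \<in> space (vilenkin_measure m). \<forall>i<n. y i = x i}"

text \<open>The digit \<open>n\<^sub>j\<close> in the mixed-radix expansion of \<open>n\<close>, see \<open>vilenkin_digit_expansion\<close>.\<close>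

definition vilenkin_digit :: "(nat \<Rightarrow> nat) \<Rightarrow> nat \<Rightarrow> nat \<Rightarrow> nat" where
  "vilenkin_digit m n j = (n div vilenkin_M m j) mod m j"

definition rademacher :: "(nat \<Rightarrow> nat) \<Rightarrow> nat \<Rightarrow> (nat \<Rightarrow> nat) \<Rightarrow> complex" where
  "rademacher m k x = exp (2 * of_real pi * \<i> * of_nat (x k) / of_nat (m k))"

text \<open>Only finitely many digits are nonzero (\<open>finite_vilenkin_digits\<close>); the remaining factors
  of the infinite product are 1.\<close>

definition vilenkin_psi :: "(nat \<Rightarrow> nat) \<Rightarrow> nat \<Rightarrow> (nat \<Rightarrow> nat) \<Rightarrow> complex" where
  "vilenkin_psi m n x =
     (\<Prod>k | vilenkin_digit m n k \<noteq> 0. rademacher m k x ^ vilenkin_digit m n k)"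

lemma vilenkin_digit_partial_expansion:
  "(\<Sum>j<k. vilenkin_digit m n j * vilenkin_M m j) = n mod vilenkin_M m k"
proof (induction k)
  case (Suc k)
  have "n mod (vilenkin_M m k * m k) =
      vilenkin_M m k * (n div vilenkin_M m k mod m k) + n mod vilenkin_M m k"
    by (rule mod_mult2_eq)
  moreover have "vilenkin_M m (Suc k) = vilenkin_M m k * m k"
    by (simp add: vilenkin_M_def mult.commute)
  ultimately show ?case
    using Suc by (simp add: vilenkin_digit_def mult.commute)
qed (simp add: vilenkin_M_def)

lemma less_vilenkin_M:
  assumes "\<And>k. 2 \<le> m k"
  shows "k < vilenkin_M m k"
proof -
  have "(\<Prod>j<k. 2) \<le> (\<Prod>j<k. m j)"
    by (rule prod_mono) (use assms in auto)
  hence "2 ^ k \<le> vilenkin_M m k"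
    by (simp add: vilenkin_M_def)
  with less_exp[of k] show ?thesis
    by (rule less_le_trans)
qed

lemma vilenkin_digit_eq_0:
  assumes "\<And>k. 2 \<le> m k" "n \<le> k"
  shows "vilenkin_digit m n k = 0"
  using less_vilenkin_M[of m k] assms by (simp add: vilenkin_digit_def)

lemma finite_vilenkin_digits:
  assumes "\<And>k. 2 \<le> m k"
  shows "finite {k. vilenkin_digit m n k \<noteq> 0}"
proof (rule finite_subset)
  show "{k. vilenkin_digit m n k \<noteq> 0} \<subseteq> {..<n}"
    using vilenkin_digit_eq_0[of m n] assms by (metis (mono_tags, lifting) lessThan_iff mem_Collect_eq not_le subsetI)
qed simp

lemma vilenkin_digit_expansion:
  assumes "\<And>k. 2 \<le> m k"
  shows "(\<Sum>j<n. vilenkin_digit m n j * vilenkin_M m j) = n"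
    and "vilenkin_digit m n j < m j"
proof -
  show "(\<Sum>j<n. vilenkin_digit m n j * vilenkin_M m j) = n"
    using less_vilenkin_M[of m n] assms by (simp add: vilenkin_digit_partial_expansion)
  show "vilenkin_digit m n j < m j"
    using assms[of j] by (simp add: vilenkin_digit_def)
qed


subsection \<open>Martingales and the spaces \<open>H\<^sub>p\<close> and weak \<open>L\<^sub>p\<close>\<close>

type_synonym vfun = "(nat \<Rightarrow> nat) \<times> (nat \<Rightarrow> nat) \<Rightarrow> complex"

definition square_filtration ::
    "(nat \<Rightarrow> nat) \<Rightarrow> nat \<Rightarrow> ((nat \<Rightarrow> nat) \<times> (nat \<Rightarrow> nat)) measure" where
  "square_filtration m n = sigma (space (vilenkin_measure2 m))
     {vilenkin_cyl m n x \<times> vilenkin_cyl m n y | x y.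
        x \<in> space (vilenkin_measure m) \<and> y \<in> space (vilenkin_measure m)}"

text \<open>The last clause states that \<open>f k\<close> is a conditional expectation of \<open>f n\<close> given the
  \<open>k\<close>-th \<open>\<sigma>\<close>-algebra; the library's conditional expectation is restricted to real-valued functions.\<close>

definition square_martingale :: "(nat \<Rightarrow> nat) \<Rightarrow> (nat \<Rightarrow> vfun) \<Rightarrow> bool" where
  "square_martingale m f \<longleftrightarrow>
     (\<forall>n. f n \<in> borel_measurable (square_filtration m n)) \<and>
     (\<forall>n. integrable (vilenkin_measure2 m) (f n)) \<and>
     (\<forall>k n. k \<le> n \<longrightarrow> (\<forall>A \<in> sets (square_filtration m k).
        set_lebesgue_integral (vilenkin_measure2 m) A (f n) =
        set_lebesgue_integral (vilenkin_measure2 m) A (f k)))"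

text \<open>\<open>x\<^sup>p\<close> on \<open>[0,\<infinity>]\<close>, for exponents \<open>p > 0\<close>.\<close>

definition ennreal_rpow :: "ennreal \<Rightarrow> real \<Rightarrow> ennreal" where
  "ennreal_rpow x p = (if x = \<top> then \<top> else ennreal (enn2real x powr p))"

definition Lp_norm ::
    "'a measure \<Rightarrow> real \<Rightarrow> ('a \<Rightarrow> ennreal) \<Rightarrow> ennreal" where
  "Lp_norm M p g = ennreal_rpow (\<integral>\<^sup>+ z. ennreal_rpow (g z) p \<partial>M) (1 / p)"

definition weak_Lp_norm ::
    "'a measure \<Rightarrow> real \<Rightarrow> ('a \<Rightarrow> complex) \<Rightarrow> ennreal" where
  "weak_Lp_norm M p g =
     (SUP l \<in> {0::real<..}. ennreal l * ennreal_rpow (emeasure M {z \<in> space M. cmod (g z) > l}) (1 / p))"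

definition maximal_function :: "(nat \<Rightarrow> 'a \<Rightarrow> complex) \<Rightarrow> 'a \<Rightarrow> ennreal" where
  "maximal_function f z = (SUP n. ennreal (cmod (f n z)))"

definition Hp_norm :: "(nat \<Rightarrow> nat) \<Rightarrow> real \<Rightarrow> (nat \<Rightarrow> vfun) \<Rightarrow> ennreal" where
  "Hp_norm m p f = Lp_norm (vilenkin_measure2 m) p (maximal_function f)"

definition Hp_square :: "(nat \<Rightarrow> nat) \<Rightarrow> real \<Rightarrow> (nat \<Rightarrow> vfun) set" where
  "Hp_square m p = {f. square_martingale m f \<and> Hp_norm m p f < \<top>}"


subsection \<open>Fourier coefficients, partial sums, modulus of continuity\<close>

definition vilenkin_fun_coeff :: "(nat \<Rightarrow> nat) \<Rightarrow> vfun \<Rightarrow> nat \<Rightarrow> nat \<Rightarrow> complex" where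
  "vilenkin_fun_coeff m g i j =
     (\<integral>z. g z * cnj (vilenkin_psi m i (fst z)) * cnj (vilenkin_psi m j (snd z)) \<partial>vilenkin_measure2 m)"

definition vilenkin_coeff :: "(nat \<Rightarrow> nat) \<Rightarrow> (nat \<Rightarrow> vfun) \<Rightarrow> nat \<Rightarrow> nat \<Rightarrow> complex" where
  "vilenkin_coeff m f i j = lim (\<lambda>k. vilenkin_fun_coeff m (f k) i j)"

definition rect_sum :: "(nat \<Rightarrow> nat) \<Rightarrow> (nat \<Rightarrow> nat \<Rightarrow> complex) \<Rightarrow> nat \<Rightarrow> nat \<Rightarrow> vfun" where
  "rect_sum m c a b z =
     (\<Sum>i<a. \<Sum>j<b. c i j * vilenkin_psi m i (fst z) * vilenkin_psi m j (snd z))"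

definition partial_sum :: "(nat \<Rightarrow> nat) \<Rightarrow> nat \<Rightarrow> nat \<Rightarrow> (nat \<Rightarrow> vfun) \<Rightarrow> vfun" where
  "partial_sum m a b f = rect_sum m (vilenkin_coeff m f) a b"

text \<open>The martingale with which an integrable function is identified.\<close>

definition fun_martingale :: "(nat \<Rightarrow> nat) \<Rightarrow> vfun \<Rightarrow> nat \<Rightarrow> vfun" where
  "fun_martingale m g k =
     rect_sum m (vilenkin_fun_coeff m g) (vilenkin_M m k) (vilenkin_M m k)"

text \<open>The modulus of continuity at \<open>1 / M\<^sub>k\<close>.\<close>

definition Hp_modulus :: "(nat \<Rightarrow> nat) \<Rightarrow> real \<Rightarrow> (nat \<Rightarrow> vfun) \<Rightarrow> nat \<Rightarrow> ennreal" where
  "Hp_modulus m p f k = Hp_norm m p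
     (\<lambda>n z. f n z - fun_martingale m (partial_sum m (vilenkin_M m k) (vilenkin_M m k) f) n z)"

text \<open>The pointwise limit of a martingale; arbitrary on the exceptional null set
  of points where the limit does not exist.\<close>

definition martingale_limit :: "(nat \<Rightarrow> vfun) \<Rightarrow> vfun" where
  "martingale_limit f z = lim (\<lambda>n. f n z)"

definition cone_filter :: "real \<Rightarrow> (nat \<times> nat) filter" where
  "cone_filter \<alpha> = inf (sequentially \<times>\<^sub>F sequentially)
     (principal {(a, b). 2 powr (- \<alpha>) \<le> real a / real b \<and> real a / real b \<le> 2 powr \<alpha>})"

end

theory Submission
  imports Defs
begin

text \<open>
  The index \<open>k\<close> below is the level of the squares; a function measurable at level \<open>k\<close> is
  constant on \<open>(M k)\<^sup>2\<close> squares of measure \<open>(M k)\<^sup>-\<^sup>2\<close>, so its integrals are finite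
  sums.

  For convergence, take \<open>M k \<le> a, b \<le> M K\<close> with \<open>M K / M k\<close> bounded, which is possible in the
  cone since the sequence is bounded. The partial sum \<open>S\<^sub>a\<^sub>,\<^sub>b\<close> reproduces \<open>f k\<close> and sees \<open>f\<close>
  only through \<open>f K\<close>, so \<open>S\<^sub>a\<^sub>,\<^sub>b f - f\<close> is \<open>S\<^sub>a\<^sub>,\<^sub>b (f K - f k)\<close> minus a martingale whose
  quasi-norm is the modulus of continuity (\<open>partial_sum_minus_martingale\<close>). Now
  \<open>f K - f k\<close> is a combination of indicators of squares, and a partial sum of one such indicator is
  \<open>(M K)\<^sup>-\<^sup>2\<close> times a product of two translated Dirichlet kernels. A Dirichlet kernel of any order
  is at most \<open>M s\<close> as soon as one of the first \<open>s\<close> coordinates is nonzero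
  (\<open>norm_dirichlet_le_M\<close>), so even the maximal kernel has a bounded integral to the power
  \<open>p < 1\<close>. Because \<open>\<bar>u + v\<bar>\<^sup>p \<le> \<bar>u\<bar>\<^sup>p + \<bar>v\<bar>\<^sup>p\<close>, the squares can be estimated separately. The total
  is \<open>(M K)\<^sup>2\<^sup>-\<^sup>2\<^sup>p\<close> times the integral of \<open>\<bar>f K - f k\<bar>\<^sup>p\<close> (\<open>Hp_pow_rect_sum_le\<close>), and the
  assumed decay of the modulus cancels precisely this factor. The argument works with squares of one
  fixed level in place of an atomic decomposition.

  For sharpness, the point mass at the identity is extremal: \<open>f n = (M n)\<^sup>2\<close> on the square of level
  \<open>n\<close> around the identity and 0 elsewhere. Its maximal function is of size \<open>(M n)\<^sup>2\<close> where it
  leaves the square of level \<open>n\<close>, hence in \<open>L\<^sub>p\<close> for \<open>p < 1\<close>, and the tail from level \<open>k\<close> on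
  gives the modulus \<open>(M k)\<^sup>2\<^sup>-\<^sup>2\<^sup>/\<^sup>p\<close> up to a constant (\<open>Hp_modulus_delta_le\<close>). Its pointwise limit
  is 0 almost everywhere, whereas its partial sum of orders \<open>a = b = M N + 1\<close> is a product of two
  kernels, each reduced to a single character of modulus 1 off a cylinder of measure \<open>1 / M N\<close>
  (\<open>weak_norm_delta_ge\<close>).
\<close>

section \<open>Powers below one and maximal functions\<close>

lemma powr_add_le:
  fixes x y p :: real
  assumes "0 \<le> x" "0 \<le> y" "0 < p" "p \<le> 1"
  shows "(x + y) powr p \<le> x powr p + y powr p"
proof (cases "x + y = 0")
  case False
  then have s: "0 < x + y" using assms by simp
  have le: "u \<le> u powr p" if "0 \<le> u" "u \<le> 1" for u :: real
    using powr_mono'[OF assms(4) that] that by simp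
  have "1 = x / (x + y) + y / (x + y)"
    using False by (simp flip: add_divide_distrib)
  also have "\<dots> \<le> (x / (x + y)) powr p + (y / (x + y)) powr p"
    using assms s by (intro add_mono le) auto
  also have "\<dots> = (x powr p + y powr p) / (x + y) powr p"
    using assms s by (simp add: powr_divide add_divide_distrib)
  finally show ?thesis using s by (simp add: pos_le_divide_eq)
qed (use assms in auto)

text \<open>
  In the estimates of maximal functions this replaces the triangle inequality: for \<open>p < 1\<close> the \<open>p\<close>-th
  power of a sum is controlled term by term.
\<close>

lemma powr_sum_le:
  fixes a :: "'i \<Rightarrow> real"
  assumes "finite I" "\<And>i. i \<in> I \<Longrightarrow> 0 \<le> a i" "0 < p" "p \<le> 1"
  shows "(\<Sum>i\<in>I. a i) powr p \<le> (\<Sum>i\<in>I. a i powr p)"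
  using assms(1,2)
proof (induction I rule: finite_induct)
  case (insert i I)
  have "(\<Sum>j\<in>insert i I. a j) powr p = (a i + (\<Sum>j\<in>I. a j)) powr p"
    using insert by simp
  also have "\<dots> \<le> a i powr p + (\<Sum>j\<in>I. a j) powr p"
    using insert assms by (intro powr_add_le sum_nonneg) auto
  also have "\<dots> \<le> a i powr p + (\<Sum>j\<in>I. a j powr p)"
    using insert by simp
  finally show ?case using insert by simp
qed simp

lemma ennreal_rpow_ennreal: "0 \<le> x \<Longrightarrow> ennreal_rpow (ennreal x) p = ennreal (x powr p)"
  by (simp add: ennreal_rpow_def)

lemma ennreal_rpow_mono:
  assumes "x \<le> y" "0 < p"
  shows "ennreal_rpow x p \<le> ennreal_rpow y p"
proof (cases "y = \<top>")
  case False
  then have "x \<noteq> \<top>" "enn2real x \<le> enn2real y"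
    using assms by (auto simp: top_unique less_top intro: enn2real_mono)
  then show ?thesis using False assms
    by (simp add: ennreal_rpow_def powr_mono2)
qed (simp add: ennreal_rpow_def)

lemma ennreal_rpow_rpow:
  assumes "0 < p" "0 < q"
  shows "ennreal_rpow (ennreal_rpow x p) q = ennreal_rpow x (p * q)"
  by (simp add: ennreal_rpow_def powr_powr)

lemma ennreal_rpow_1 [simp]: "ennreal_rpow x 1 = x"
  by (simp add: ennreal_rpow_def less_top)

lemma borel_measurable_ennreal_rpow [measurable]:
  assumes [measurable]: "f \<in> borel_measurable N"
  shows "(\<lambda>z. ennreal_rpow (f z) p) \<in> borel_measurable N"
  unfolding ennreal_rpow_def by measurable

text \<open>
  Taking \<open>p\<close>-th roots turns the bound into one for each \<open>\<bar>h n z\<bar>\<close>, over which the supremum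
  can be taken.
\<close>

lemma ennreal_rpow_maximal_le:
  assumes "0 < p" "\<And>n. ennreal (cmod (h n z) powr p) \<le> X"
  shows "ennreal_rpow (maximal_function h z) p \<le> X"
proof -
  have "maximal_function h z \<le> ennreal_rpow X (1 / p)"
    unfolding maximal_function_def
  proof (rule SUP_least)
    fix n
    have "ennreal (cmod (h n z)) = ennreal_rpow (ennreal (cmod (h n z) powr p)) (1 / p)"
      using assms(1) by (simp add: ennreal_rpow_ennreal powr_powr)
    also have "\<dots> \<le> ennreal_rpow X (1 / p)"
      using assms by (intro ennreal_rpow_mono) auto
    finally show "ennreal (cmod (h n z)) \<le> ennreal_rpow X (1 / p)" .
  qed
  then have "ennreal_rpow (maximal_function h z) p \<le> ennreal_rpow (ennreal_rpow X (1 / p)) p"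
    using assms(1) by (rule ennreal_rpow_mono)
  then show ?thesis using assms(1) by (simp add: ennreal_rpow_rpow)
qed

lemma le_ennreal_rpow_maximal:
  assumes "0 < p"
  shows "ennreal (cmod (h n z) powr p) \<le> ennreal_rpow (maximal_function h z) p"
proof -
  have "ennreal_rpow (ennreal (cmod (h n z))) p \<le> ennreal_rpow (maximal_function h z) p"
    unfolding maximal_function_def using assms by (intro ennreal_rpow_mono SUP_upper) auto
  then show ?thesis by (simp add: ennreal_rpow_ennreal)
qed

section \<open>Mixed-radix digits and the Vilenkin system\<close>

text \<open>
  The boundedness of the sequence is a hypothesis of the individual estimates, in the form of a
  constant \<open>B\<close> that enters their right-hand sides.
\<close>

locale vilenkin =
  fixes m :: "nat \<Rightarrow> nat"
  assumes m_ge_2: "2 \<le> m k"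
begin

abbreviation "M \<equiv> vilenkin_M m"
abbreviation "digit \<equiv> vilenkin_digit m"
abbreviation "\<psi> \<equiv> vilenkin_psi m"
abbreviation "\<mu> \<equiv> vilenkin_measure m"
abbreviation "\<mu>2 \<equiv> vilenkin_measure2 m"
abbreviation "cyl \<equiv> vilenkin_cyl m"

lemma M_0 [simp]: "M 0 = 1"
  by (simp add: vilenkin_M_def)

lemma M_Suc: "M (Suc k) = M k * m k"
  by (simp add: vilenkin_M_def mult.commute)

lemma m_pos: "0 < m k"
  using m_ge_2[of k] by simp

lemma M_pos [simp]: "0 < M k"
  by (simp add: vilenkin_M_def m_pos prod_pos)

lemma M_nonzero [simp]: "M k \<noteq> 0"
  using M_pos[of k] by simp

lemma M_dvd: "j \<le> k \<Longrightarrow> M j dvd M k"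
  by (induction k rule: dec_induct) (auto simp: M_Suc)

lemma M_mono: "j \<le> k \<Longrightarrow> M j \<le> M k"
  using M_dvd by (simp add: dvd_imp_le)

lemma M_min: "M (min n k) = min (M n) (M k)"
  by (rule min_of_mono [symmetric]) (simp add: mono_def M_mono)

lemma M_growth: "2 ^ i * M k \<le> M (k + i)"
proof (induction i)
  case (Suc i)
  have "2 ^ Suc i * M k = 2 ^ i * M k * 2" by simp
  also have "\<dots> \<le> M (k + i) * m (k + i)"
    using Suc m_ge_2 by (intro mult_mono) auto
  finally show ?case by (simp add: M_Suc)
qed simp

lemma less_M: "k < M k"
  by (rule less_vilenkin_M) (rule m_ge_2)

lemma digit_less: "digit n j < m j"
  by (simp add: vilenkin_digit_def m_pos)

lemma digit_0 [simp]: "digit 0 j = 0"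
  by (simp add: vilenkin_digit_def)

lemma digit_eq_0: "n < M k \<Longrightarrow> k \<le> j \<Longrightarrow> digit n j = 0"
  using M_mono[of k j] by (simp add: vilenkin_digit_def)

text \<open>
  In mixed radix, \<open>q * M k\<close> occupies the digits from \<open>k\<close> on and a number below \<open>M k\<close>
  those before \<open>k\<close>, so adding them produces no carries.
\<close>

lemma digit_add_low:
  assumes "j < k"
  shows "digit (i + q * M k) j = digit i j"
proof -
  obtain c where c: "M k = M j * (m j * c)"
    using M_dvd[of "Suc j" k] assms by (auto simp: M_Suc dvd_def mult.assoc)
  have "(i + q * M k) div M j = (i + M j * (m j * (c * q))) div M j"
    by (simp add: c algebra_simps)
  also have "\<dots> = i div M j + m j * (c * q)"
    by simp
  finally show ?thesis by (simp add: vilenkin_digit_def)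
qed

lemma digit_add_high:
  assumes "i < M k" "k \<le> j"
  shows "digit (i + q * M k) j = digit (q * M k) j"
proof -
  obtain c where "M j = M k * c"
    using M_dvd[OF assms(2)] by (auto simp: dvd_def)
  with assms(1) show ?thesis by (simp add: vilenkin_digit_def div_mult2_eq)
qed

lemma digit_mult_low: "j < k \<Longrightarrow> digit (q * M k) j = 0"
  using digit_add_low[of j k 0 q] by simp

lemma digit_mult_M: "d < m k \<Longrightarrow> digit (d * M k) k = d"
  by (simp add: vilenkin_digit_def)

lemma digits_inject:
  assumes "q < M k" "r < M k" "\<forall>j<k. digit q j = digit r j"
  shows "q = r"
proof -
  have "q mod M k = r mod M k"
    using assms(3) by (simp flip: vilenkin_digit_partial_expansion)
  with assms(1,2) show ?thesis by simp
qed

text \<open>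
  The points \<open>digit q\<close> with \<open>q < M k\<close> meet each cylinder of level \<open>k\<close> exactly once
  (uniqueness is \<open>digits_inject\<close>). They serve as the representatives of the cylinders.
\<close>

lemma ex_index_of_digits:
  assumes "\<forall>j. x j < m j"
  shows "\<exists>q<M k. \<forall>j<k. digit q j = x j"
proof (induction k)
  case (Suc k)
  then obtain q where q: "q < M k" "\<forall>j<k. digit q j = x j" by blast
  have "q + x k * M k < Suc (x k) * M k"
    using q(1) by simp
  also have "\<dots> \<le> M (Suc k)"
    unfolding M_Suc by (subst mult.commute, rule mult_le_mono2) (use assms in \<open>simp add: Suc_le_eq\<close>)
  finally have "q + x k * M k < M (Suc k)" .
  moreover have "digit (q + x k * M k) j = x j" if "j < Suc k" for j
  proof (cases "j = k")
    case True
    then show ?thesis using q assms by (simp add: digit_add_high digit_mult_M)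
  next
    case False
    then show ?thesis using that q by (simp add: digit_add_low)
  qed
  ultimately show ?case by blast
qed simp


lemma rademacher_cis: "rademacher m k x = cis (2 * pi * real (x k) / real (m k))"
  by (simp add: rademacher_def cis_conv_exp mult_ac)

lemma norm_rademacher [simp]: "cmod (rademacher m k x) = 1"
  by (simp add: rademacher_cis)

lemma norm_psi [simp]: "cmod (\<psi> n x) = 1"
  by (simp add: vilenkin_psi_def prod_norm [symmetric] norm_power)

lemma psi_eq_prod:
  assumes "n < M k"
  shows "\<psi> n x = (\<Prod>j<k. rademacher m j x ^ digit n j)"
  unfolding vilenkin_psi_def
proof (rule prod.mono_neutral_left)
  show "{j. digit n j \<noteq> 0} \<subseteq> {..<k}"
  proof
    fix j
    assume "j \<in> {j. digit n j \<noteq> 0}"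
    then have "\<not> k \<le> j"
      using digit_eq_0[OF assms, of j] by auto
    then show "j \<in> {..<k}" by simp
  qed
qed auto

lemma psi_cong:
  assumes "n < M k" "\<forall>j<k. x j = y j"
  shows "\<psi> n x = \<psi> n y"
  using assms(2) by (simp add: psi_eq_prod[OF assms(1)] rademacher_def)

lemma psi_add:
  assumes "i < M k"
  shows "\<psi> (i + q * M k) x = \<psi> i x * \<psi> (q * M k) x"
proof -
  define N where "N = i + q * M k"
  have N: "i < M N" "q * M k < M N" "i + q * M k < M N"
    using less_M[of N] by (simp_all add: N_def)
  have "rademacher m j x ^ digit (i + q * M k) j =
        rademacher m j x ^ digit i j * rademacher m j x ^ digit (q * M k) j" for j
  proof (cases "j < k")
    case True
    then show ?thesis
      by (simp only: digit_add_low digit_mult_low power_0 mult_1_right)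
  next
    case False
    then show ?thesis
      by (simp only: digit_add_high[OF assms] digit_eq_0[OF assms] not_less power_0 mult_1_left)
  qed
  then show ?thesis
    unfolding psi_eq_prod[OF N(1)] psi_eq_prod[OF N(2)] psi_eq_prod[OF N(3)]
    by (simp only: prod.distrib)
qed

lemma psi_mult_M:
  assumes "d < m k"
  shows "\<psi> (d * M k) x = rademacher m k x ^ d"
proof -
  have "d * M k < M (Suc k)"
    using assms by (simp add: M_Suc mult.commute)
  from psi_eq_prod[OF this] assms show ?thesis
    by (simp add: digit_mult_low digit_mult_M)
qed

text \<open>
  Both sides are \<open>exp (2 \<pi> i \<Sum>j. i\<^sub>j q\<^sub>j / m\<^sub>j)\<close>, which is symmetric in the two numbers.
  This makes the orthogonality of the characters follow from the formula for the Dirichlet kernel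
  of order \<open>M k\<close>.
\<close>

lemma psi_digit_commute:
  assumes "i < M k" "q < M k"
  shows "\<psi> i (digit q) = \<psi> q (digit i)"
  unfolding psi_eq_prod[OF assms(1)] psi_eq_prod[OF assms(2)] rademacher_cis
  by (simp add: Complex.DeMoivre mult_ac)

section \<open>Dirichlet kernels\<close>

text \<open>
  The kernel \<open>D\<^sub>a(x - t)\<close>, written as a function of two points, so that the group
  subtraction does not have to be introduced.
\<close>

definition dirichlet :: "nat \<Rightarrow> (nat \<Rightarrow> nat) \<Rightarrow> (nat \<Rightarrow> nat) \<Rightarrow> complex" where
  "dirichlet a x t = (\<Sum>i<a. \<psi> i x * cnj (\<psi> i t))"

lemma norm_dirichlet_le: "cmod (dirichlet a x t) \<le> real a"
proof -
  have "cmod (dirichlet a x t) \<le> (\<Sum>i<a. cmod (\<psi> i x * cnj (\<psi> i t)))"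
    unfolding dirichlet_def by (rule norm_sum)
  then show ?thesis by (simp add: norm_mult)
qed

lemma dirichlet_add_block:
  assumes "r \<le> M s"
  shows "dirichlet (q * M s + r) x t = dirichlet (q * M s) x t + \<psi> (q * M s) x * cnj (\<psi> (q * M s) t) * dirichlet r x t"
  using assms
proof (induction r)
  case (Suc r)
  have "dirichlet (q * M s + Suc r) x t =
      dirichlet (q * M s + r) x t + \<psi> (r + q * M s) x * cnj (\<psi> (r + q * M s) t)"
    by (simp add: dirichlet_def add.commute)
  with Suc show ?case by (simp add: psi_add dirichlet_def algebra_simps)
qed (simp add: dirichlet_def)

text \<open>
  The base of the powers is an \<open>m s\<close>-th root of unity, and it is 1 only if the two
  coordinates agree.
\<close>

lemma sum_rademacher_powers:
  assumes "x s < m s" "t s < m s"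
  shows "(\<Sum>e<m s. (rademacher m s x * cnj (rademacher m s t)) ^ e) =
         (if x s = t s then of_nat (m s) else 0)"
proof -
  define w where "w = rademacher m s x * cnj (rademacher m s t)"
  have unit: "rademacher m s t * cnj (rademacher m s t) = 1" for t
    by (simp add: complex_norm_square [symmetric])
  show ?thesis
  proof (cases "x s = t s")
    case True
    then have "w = 1" using unit[of t] by (simp add: w_def rademacher_def)
    with True show ?thesis by (simp add: w_def)
  next
    case False
    note bij = Complex.bij_betw_roots_unity[OF m_pos[of s]]
    have root: "rademacher m s y ^ m s = 1" if "y s < m s" for y
      using bij_betwE[OF bij] that by (auto simp: rademacher_cis)
    have "rademacher m s x \<noteq> rademacher m s t"
      using bij_betw_imp_inj_on[OF bij] False assms
      unfolding rademacher_cis inj_on_def by blast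
    moreover have "rademacher m s x = w * rademacher m s t"
      unfolding w_def using unit[of t] by (simp add: mult.assoc mult.commute)
    ultimately have "w \<noteq> 1" by auto
    moreover have "w ^ m s = 1"
      using root assms by (simp add: w_def power_mult_distrib flip: complex_cnj_power)
    ultimately show ?thesis using False
      by (simp add: geometric_sum flip: w_def)
  qed
qed

text \<open>
  The kernel of order \<open>M s\<close> factors into one full geometric sum per coordinate.
\<close>

lemma dirichlet_M:
  assumes "\<forall>j. x j < m j" "\<forall>j. t j < m j"
  shows "dirichlet (M s) x t = (if \<forall>j<s. x j = t j then of_nat (M s) else 0)"
proof (induction s)
  case 0
  show ?case by (simp add: dirichlet_def vilenkin_psi_def)
next
  case (Suc s)
  define w where "w = rademacher m s x * cnj (rademacher m s t)"
  have "dirichlet (d * M s) x t = (\<Sum>e<d. w ^ e) * dirichlet (M s) x t" if "d \<le> m s" for d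
    using that
  proof (induction d)
    case (Suc d)
    have "dirichlet (Suc d * M s) x t = dirichlet (d * M s + M s) x t" by (simp add: add.commute)
    also have "\<dots> = dirichlet (d * M s) x t + w ^ d * dirichlet (M s) x t"
      using Suc.prems by (subst dirichlet_add_block) (simp_all add: psi_mult_M w_def power_mult_distrib)
    finally show ?case using Suc by (simp add: algebra_simps)
  qed (simp add: dirichlet_def)
  from this[of "m s"]
  have "dirichlet (M (Suc s)) x t = (\<Sum>e<m s. w ^ e) * dirichlet (M s) x t"
    by (simp add: M_Suc mult.commute)
  also have "(\<Sum>e<m s. w ^ e) = (if x s = t s then of_nat (m s) else 0)"
    unfolding w_def using assms by (intro sum_rademacher_powers) auto
  finally show ?case
    by (auto simp: Suc.IH M_Suc less_Suc_eq)
qed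

text \<open>
  If the points differ within the first \<open>s\<close> coordinates, every complete block of \<open>M s\<close>
  consecutive characters sums to 0. Only the incomplete last block is left, and it has fewer than
  \<open>M s\<close> terms of modulus 1. The bound does not involve the order of the kernel.
\<close>

lemma norm_dirichlet_le_M:
  assumes "\<forall>j. x j < m j" "\<forall>j. t j < m j" "\<not> (\<forall>j<s. x j = t j)"
  shows "cmod (dirichlet a x t) \<le> real (M s)"
proof -
  have "dirichlet (M s) x t = 0"
    using dirichlet_M[OF assms(1,2), of s] assms(3) by auto
  then have "dirichlet (q * M s) x t = 0" for q
  proof (induction q)
    case (Suc q)
    then show ?case using dirichlet_add_block[of "M s" s q x t] by (simp add: add.commute)
  qed (simp add: dirichlet_def)
  moreover have "a = (a div M s) * M s + a mod M s"
    by (rule div_mult_mod_eq [symmetric])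
  moreover have le: "a mod M s \<le> M s" using mod_less_divisor[OF M_pos] by (simp add: less_imp_le)
  ultimately have "cmod (dirichlet a x t) = cmod (dirichlet (a mod M s) x t)"
    using dirichlet_add_block[OF le, of "a div M s" x t] by (simp add: norm_mult)
  also have "\<dots> \<le> real (a mod M s)" by (rule norm_dirichlet_le)
  finally show ?thesis using le by linarith
qed

section \<open>Cylinders, squares and cell-constant functions\<close>

abbreviation "G \<equiv> space \<mu>"

lemma digit_in_G [simp]: "digit n \<in> G"
  by (simp add: space_vilenkin_measure digit_less)

lemma prob_space_uniform: "prob_space (uniform_count_measure {..<m k})"
  using m_pos[of k] by (intro prob_space_uniform_count_measure) auto

lemma prob_space_mu: "prob_space \<mu>"
  unfolding vilenkin_measure_def by (rule prob_space_PiM) (rule prob_space_uniform)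

sublocale mu: prob_space \<mu>
  by (rule prob_space_mu)

sublocale mu_mu: pair_prob_space \<mu> \<mu>
  by (simp add: pair_prob_space_def pair_sigma_finite_def prob_space_mu mu.sigma_finite_measure)

lemma cyl_eq_prod_emb:
  assumes "x \<in> G"
  shows "cyl n x = prod_emb UNIV (\<lambda>k. uniform_count_measure {..<m k}) {..<n} (Pi\<^sub>E {..<n} (\<lambda>i. {x i}))"
  using assms
  by (auto simp: vilenkin_cyl_def space_vilenkin_measure prod_emb_def space_uniform_count_measure
      PiE_def Pi_def)

lemma sets_cyl [measurable]:
  assumes "x \<in> G"
  shows "cyl n x \<in> sets \<mu>"
  unfolding cyl_eq_prod_emb[OF assms] vilenkin_measure_def
  by (rule sets_PiM_I) (use assms in \<open>auto simp: sets_uniform_count_measure space_vilenkin_measure\<close>)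

lemma measure_cyl:
  assumes "x \<in> G"
  shows "measure \<mu> (cyl n x) = 1 / real (M n)"
proof -
  interpret product_prob_space "\<lambda>k. uniform_count_measure {..<m k}" UNIV
    by (simp add: product_prob_space_def product_sigma_finite_def product_prob_space_axioms_def
        prob_space_uniform prob_space_imp_sigma_finite)
  have "measure \<mu> (cyl n x) = (\<Prod>i<n. measure (uniform_count_measure {..<m i}) {x i})"
    unfolding cyl_eq_prod_emb[OF assms] vilenkin_measure_def
    by (rule measure_PiM_emb) (use assms in \<open>auto simp: sets_uniform_count_measure space_vilenkin_measure\<close>)
  also have "\<dots> = (\<Prod>i<n. 1 / real (m i))"
    using assms by (intro prod.cong) (auto simp: measure_uniform_count_measure space_vilenkin_measure)
  finally show ?thesis by (simp add: vilenkin_M_def prod_dividef)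
qed

lemma emeasure_cyl: "x \<in> G \<Longrightarrow> emeasure \<mu> (cyl n x) = ennreal (1 / real (M n))"
  by (simp add: mu.emeasure_eq_measure measure_cyl)

lemma space_mu2: "space \<mu>2 = G \<times> G"
  by (simp add: vilenkin_measure2_def space_pair_measure)

lemma sets_mu2: "A \<in> sets \<mu> \<Longrightarrow> B \<in> sets \<mu> \<Longrightarrow> A \<times> B \<in> sets \<mu>2"
  by (simp add: vilenkin_measure2_def)

lemma emeasure_mu2_Times:
  "A \<in> sets \<mu> \<Longrightarrow> B \<in> sets \<mu> \<Longrightarrow> emeasure \<mu>2 (A \<times> B) = emeasure \<mu> A * emeasure \<mu> B"
  by (simp add: vilenkin_measure2_def mu.emeasure_pair_measure_Times)

lemma emeasure_mu2_cyl_Times: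
  "x \<in> G \<Longrightarrow> y \<in> G \<Longrightarrow> emeasure \<mu>2 (cyl k x \<times> cyl l y) = ennreal (1 / (real (M k) * real (M l)))"
  by (simp add: emeasure_mu2_Times sets_cyl emeasure_cyl flip: ennreal_mult)

sublocale mu2: prob_space \<mu>2
  unfolding vilenkin_measure2_def by (rule mu_mu.prob_space_axioms)

text \<open>
  Functions that depend only on the first \<open>k\<close> coordinates of both points, that is, that are
  constant on the squares generating the \<open>k\<close>-th \<open>\<sigma>\<close>-algebra. The condition is restricted
  to the carrier because functions are arbitrary outside it.
\<close>

definition cell_const :: "nat \<Rightarrow> ((nat \<Rightarrow> nat) \<times> (nat \<Rightarrow> nat) \<Rightarrow> 'a) \<Rightarrow> bool" where
  "cell_const k g \<longleftrightarrow> (\<forall>x\<in>G. \<forall>y\<in>G. \<forall>x'\<in>G. \<forall>y'\<in>G.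
     (\<forall>j<k. x j = x' j \<and> y j = y' j) \<longrightarrow> g (x, y) = g (x', y'))"

text \<open>
  The squares of level \<open>k\<close> are numbered by \<open>idx k\<close>; \<open>rep w\<close> is a point of the square
  with number \<open>w\<close>, the same one at every level. Integrals of cell-constant functions thereby
  become finite sums over \<open>idx k\<close>.
\<close>

definition idx :: "nat \<Rightarrow> (nat \<times> nat) set" where
  "idx k = {..<M k} \<times> {..<M k}"

definition rep :: "nat \<times> nat \<Rightarrow> (nat \<Rightarrow> nat) \<times> (nat \<Rightarrow> nat)" where
  "rep w = (digit (fst w), digit (snd w))"

definition cell :: "nat \<Rightarrow> nat \<times> nat \<Rightarrow> ((nat \<Rightarrow> nat) \<times> (nat \<Rightarrow> nat)) set" where
  "cell k w = cyl k (digit (fst w)) \<times> cyl k (digit (snd w))"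

lemma finite_idx [simp]: "finite (idx k)"
  by (simp add: idx_def)

lemma rep_in_space [simp]: "rep w \<in> space \<mu>2"
  by (simp add: rep_def space_mu2)

lemma sets_cell [measurable]: "cell k w \<in> sets \<mu>2"
  by (simp add: cell_def sets_mu2 sets_cyl)

lemma emeasure_cell: "emeasure \<mu>2 (cell k w) = ennreal (1 / (real (M k))\<^sup>2)"
  by (simp add: cell_def emeasure_mu2_cyl_Times power2_eq_square)

lemma measure_cell: "measure \<mu>2 (cell k w) = 1 / (real (M k))\<^sup>2"
  by (simp add: measure_def emeasure_cell)

lemma ex_cell:
  assumes "z \<in> space \<mu>2"
  obtains w where "w \<in> idx k" "\<And>v. v \<in> idx k \<Longrightarrow> z \<in> cell k v \<longleftrightarrow> v = w"
proof -
  obtain x y where z: "z = (x, y)" "x \<in> G" "y \<in> G"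
    using assms by (auto simp: space_mu2)
  have *: "\<exists>q<M k. \<forall>v<M k. x \<in> cyl k (digit v) \<longleftrightarrow> v = q" if "x \<in> G" for x
  proof -
    obtain q where q: "q < M k" "\<forall>j<k. digit q j = x j"
      using ex_index_of_digits[of x k] \<open>x \<in> G\<close> by (auto simp: space_vilenkin_measure)
    have "x \<in> cyl k (digit v) \<longleftrightarrow> v = q" if "v < M k" for v
      using digits_inject[OF that q(1)] q(2) \<open>x \<in> G\<close> by (auto simp: vilenkin_cyl_def)
    with q(1) show ?thesis by blast
  qed
  obtain q where q: "q < M k" "\<And>v. v < M k \<Longrightarrow> x \<in> cyl k (digit v) \<longleftrightarrow> v = q"
    using *[OF z(2)] by blast
  obtain r where r: "r < M k" "\<And>v. v < M k \<Longrightarrow> y \<in> cyl k (digit v) \<longleftrightarrow> v = r"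
    using *[OF z(3)] by blast
  show thesis
  proof (rule that[of "(q, r)"])
    show "(q, r) \<in> idx k" using q r by (simp add: idx_def)
    show "z \<in> cell k v \<longleftrightarrow> v = (q, r)" if "v \<in> idx k" for v
      using that q(2)[of "fst v"] r(2)[of "snd v"] z(1)
      by (auto simp: idx_def cell_def)
  qed
qed

lemma cell_const_eq_rep:
  assumes "cell_const k g" "z \<in> space \<mu>2" "z \<in> cell k w"
  shows "g z = g (rep w)"
proof -
  obtain x y where z: "z = (x, y)" "x \<in> G" "y \<in> G"
    using assms(2) by (auto simp: space_mu2)
  have "\<forall>j<k. x j = digit (fst w) j \<and> y j = digit (snd w) j"
    using assms(3) z by (simp add: cell_def vilenkin_cyl_def)
  with assms(1) z(2,3) show ?thesis
    unfolding z(1) rep_def cell_const_def by (meson digit_in_G)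
qed

lemma sum_over_cells:
  fixes g :: "_ \<Rightarrow> 'a :: real_vector"
  assumes "z \<in> space \<mu>2" "cell_const k g"
  shows "(\<Sum>w\<in>idx k. indicator (cell k w) z *\<^sub>R g (rep w)) = g z"
proof -
  obtain w where w: "w \<in> idx k" "\<And>v. v \<in> idx k \<Longrightarrow> z \<in> cell k v \<longleftrightarrow> v = w"
    using ex_cell[OF assms(1)] by blast
  then have "g z = g (rep w)"
    using cell_const_eq_rep[OF assms(2,1)] by blast
  have "(\<Sum>v\<in>idx k. indicator (cell k v) z *\<^sub>R g (rep v)) = (\<Sum>v\<in>idx k. if v = w then g (rep v) else 0)"
    using w by (intro sum.cong) (auto simp: indicator_def)
  with \<open>g z = g (rep w)\<close> w(1) show ?thesis by (simp add: sum.delta)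
qed

lemma integral_times_cell_const:
  fixes g \<phi> :: vfun
  assumes "integrable \<mu>2 g" "cell_const k \<phi>"
  shows "(\<integral>z. g z * \<phi> z \<partial>\<mu>2) = (\<Sum>w\<in>idx k. (\<integral>z\<in>cell k w. g z \<partial>\<mu>2) * \<phi> (rep w))"
proof -
  have "(\<integral>z. g z * \<phi> z \<partial>\<mu>2) =
      (\<integral>z. (\<Sum>w\<in>idx k. (indicator (cell k w) z *\<^sub>R g z) * \<phi> (rep w)) \<partial>\<mu>2)"
  proof (rule Bochner_Integration.integral_cong)
    fix z assume "z \<in> space \<mu>2"
    from sum_over_cells[OF this assms(2)] 
    have "g z * \<phi> z = g z * (\<Sum>w\<in>idx k. indicator (cell k w) z *\<^sub>R \<phi> (rep w))" by simp
    then show "g z * \<phi> z = (\<Sum>w\<in>idx k. (indicator (cell k w) z *\<^sub>R g z) * \<phi> (rep w))"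
      by (simp add: sum_distrib_left)
  qed simp
  also have "\<dots> = (\<Sum>w\<in>idx k. (\<integral>z\<in>cell k w. g z \<partial>\<mu>2) * \<phi> (rep w))"
    unfolding set_lebesgue_integral_def
    by (subst Bochner_Integration.integral_sum)
      (auto simp del: mult_scaleR_left intro!: integrable_mult_left integrable_mult_indicator assms)
  finally show ?thesis .
qed

lemma integral_cell_const:
  fixes \<phi> :: vfun
  assumes "cell_const k \<phi>"
  shows "(\<integral>z. \<phi> z \<partial>\<mu>2) = (\<Sum>w\<in>idx k. \<phi> (rep w)) / (of_nat (M k))\<^sup>2"
proof -
  have "(\<integral>z\<in>cell k w. (1 :: complex) \<partial>\<mu>2) = 1 / (of_nat (M k))\<^sup>2" for w
    by (simp add: set_lebesgue_integral_def measure_cell scaleR_conv_of_real)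
  then show ?thesis
    using integral_times_cell_const[OF _ assms, of "\<lambda>_. 1"] by (simp add: sum_divide_distrib)
qed

lemma nn_integral_cell_const:
  assumes "cell_const k \<phi>"
  shows "(\<integral>\<^sup>+ z. ennreal (\<phi> z) \<partial>\<mu>2) = (\<Sum>w\<in>idx k. ennreal (\<phi> (rep w)) * ennreal (1 / (real (M k))\<^sup>2))"
proof -
  have "(\<integral>\<^sup>+ z. ennreal (\<phi> z) \<partial>\<mu>2) = (\<integral>\<^sup>+ z. (\<Sum>w\<in>idx k. ennreal (\<phi> (rep w)) * indicator (cell k w) z) \<partial>\<mu>2)"
  proof (rule nn_integral_cong)
    fix z assume z: "z \<in> space \<mu>2"
    obtain w where w: "w \<in> idx k" "\<And>v. v \<in> idx k \<Longrightarrow> z \<in> cell k v \<longleftrightarrow> v = w"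
      using ex_cell[OF z] by blast
    then have "\<phi> z = \<phi> (rep w)"
      using cell_const_eq_rep[OF assms z] by blast
    have "(\<Sum>v\<in>idx k. ennreal (\<phi> (rep v)) * indicator (cell k v) z) =
        (\<Sum>v\<in>idx k. if v = w then ennreal (\<phi> (rep v)) else 0)"
      using w by (intro sum.cong) (auto simp: indicator_def)
    with \<open>\<phi> z = \<phi> (rep w)\<close> w(1)
    show "ennreal (\<phi> z) = (\<Sum>v\<in>idx k. ennreal (\<phi> (rep v)) * indicator (cell k v) z)"
      by (simp add: sum.delta)
  qed
  also have "\<dots> = (\<Sum>w\<in>idx k. \<integral>\<^sup>+ z. ennreal (\<phi> (rep w)) * indicator (cell k w) z \<partial>\<mu>2)"
    by (rule nn_integral_sum) simp
  finally show ?thesis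
    by (simp only: nn_integral_cmult_indicator sets_cell emeasure_cell)
qed

section \<open>Fourier coefficients and rectangular partial sums\<close>

lemma cell_const_psi:
  assumes "i < M k" "j < M k"
  shows "cell_const k (\<lambda>z. c * cnj (\<psi> i (fst z)) * cnj (\<psi> j (snd z)))"
  unfolding cell_const_def
proof (intro ballI impI)
  fix x y x' y' :: "nat \<Rightarrow> nat"
  assume "\<forall>l<k. x l = x' l \<and> y l = y' l"
  then have "\<psi> i x = \<psi> i x'" "\<psi> j y = \<psi> j y'"
    using assms by (auto intro!: psi_cong[of _ k])
  then show "c * cnj (\<psi> i (fst (x, y))) * cnj (\<psi> j (snd (x, y))) =
      c * cnj (\<psi> i (fst (x', y'))) * cnj (\<psi> j (snd (x', y')))"
    by simp
qed

lemma cell_const_mult: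
  fixes g h :: "_ \<Rightarrow> 'a :: times"
  assumes "cell_const k g" "cell_const k h"
  shows "cell_const k (\<lambda>z. g z * h z)"
  using assms unfolding cell_const_def by (intro ballI impI arg_cong2[where f = times]) blast+

lemma cell_const_diff:
  fixes g h :: "_ \<Rightarrow> 'a :: minus"
  assumes "cell_const k g" "cell_const k h"
  shows "cell_const k (\<lambda>z. g z - h z)"
  using assms unfolding cell_const_def by (intro ballI impI arg_cong2[where f = minus]) blast+

lemma fun_coeff_eq_sum_cells:
  assumes "integrable \<mu>2 g" "i < M k" "j < M k"
  shows "vilenkin_fun_coeff m g i j =
    (\<Sum>w\<in>idx k. (\<integral>z\<in>cell k w. g z \<partial>\<mu>2) * (cnj (\<psi> i (fst (rep w))) * cnj (\<psi> j (snd (rep w)))))"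
  using integral_times_cell_const[OF assms(1) cell_const_psi[OF assms(2,3), of 1]]
  by (simp add: vilenkin_fun_coeff_def mult.assoc)

lemma fun_coeff_cell_const:
  assumes "cell_const k g" "i < M k" "j < M k"
  shows "vilenkin_fun_coeff m g i j =
    (\<Sum>w\<in>idx k. g (rep w) * cnj (\<psi> i (fst (rep w))) * cnj (\<psi> j (snd (rep w)))) / (of_nat (M k))\<^sup>2"
  using integral_cell_const[OF cell_const_mult[OF assms(1) cell_const_psi[OF assms(2,3), of 1]]]
  by (simp add: vilenkin_fun_coeff_def mult.assoc)

text \<open>
  The partial sum as a convolution with the product of two Dirichlet kernels. For a cell-constant
  function the convolution integral is a finite sum, in which each square contributes a multiple
  of one translated product of kernels.
\<close>

lemma rect_sum_fun_coeff:
  assumes "cell_const k g" "a \<le> M k" "b \<le> M k"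
  shows "rect_sum m (vilenkin_fun_coeff m g) a b z =
    (\<Sum>w\<in>idx k. g (rep w) * dirichlet a (fst z) (fst (rep w)) * dirichlet b (snd z) (snd (rep w))) / (of_nat (M k))\<^sup>2"
proof -
  define T where "T = (\<lambda>i j w. g (rep w) * (\<psi> i (fst z) * cnj (\<psi> i (fst (rep w)))) *
    (\<psi> j (snd z) * cnj (\<psi> j (snd (rep w)))) / (of_nat (M k))\<^sup>2)"
  have "rect_sum m (vilenkin_fun_coeff m g) a b z = (\<Sum>i<a. \<Sum>j<b. \<Sum>w\<in>idx k. T i j w)"
    unfolding rect_sum_def
    using assms by (intro sum.cong refl)
      (simp add: fun_coeff_cell_const T_def sum_divide_distrib sum_distrib_left mult_ac)
  also have "\<dots> = (\<Sum>i<a. \<Sum>w\<in>idx k. \<Sum>j<b. T i j w)"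
    by (intro sum.cong refl) (rule sum.swap)
  also have "\<dots> = (\<Sum>w\<in>idx k. \<Sum>i<a. \<Sum>j<b. T i j w)"
    by (rule sum.swap)
  also have "\<dots> = (\<Sum>w\<in>idx k. g (rep w) * dirichlet a (fst z) (fst (rep w)) * dirichlet b (snd z) (snd (rep w)) / (of_nat (M k))\<^sup>2)"
  proof (intro sum.cong refl)
    fix w
    have DD: "dirichlet a (fst z) (fst (rep w)) * dirichlet b (snd z) (snd (rep w)) =
        (\<Sum>i<a. \<Sum>j<b. (\<psi> i (fst z) * cnj (\<psi> i (fst (rep w)))) * (\<psi> j (snd z) * cnj (\<psi> j (snd (rep w)))))"
      by (simp only: dirichlet_def sum_product)
    have "g (rep w) * (dirichlet a (fst z) (fst (rep w)) * dirichlet b (snd z) (snd (rep w))) / (of_nat (M k))\<^sup>2 =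
        (\<Sum>i<a. \<Sum>j<b. T i j w)"
      unfolding DD T_def by (simp only: sum_distrib_left sum_divide_distrib mult.assoc)
    then show "(\<Sum>i<a. \<Sum>j<b. T i j w) =
        g (rep w) * dirichlet a (fst z) (fst (rep w)) * dirichlet b (snd z) (snd (rep w)) / (of_nat (M k))\<^sup>2"
      by (simp add: mult.assoc)
  qed
  finally show ?thesis by (simp add: sum_divide_distrib)
qed

lemma rect_sum_fun_coeff_M:
  assumes "cell_const k g" "z \<in> space \<mu>2"
  shows "rect_sum m (vilenkin_fun_coeff m g) (M k) (M k) z = g z"
proof -
  have DD: "dirichlet (M k) (fst z) (fst (rep w)) * dirichlet (M k) (snd z) (snd (rep w)) =
      (of_nat (M k))\<^sup>2 * indicator (cell k w) z" for w
    using assms(2)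
    by (subst (1 2) dirichlet_M)
      (auto simp: space_mu2 space_vilenkin_measure rep_def digit_less cell_def vilenkin_cyl_def
        indicator_def power2_eq_square)
  have "rect_sum m (vilenkin_fun_coeff m g) (M k) (M k) z =
      (\<Sum>w\<in>idx k. of_real (indicator (cell k w) z) * g (rep w))"
    unfolding rect_sum_fun_coeff[OF assms(1) order_refl order_refl] sum_divide_distrib
    by (intro sum.cong refl) (simp add: mult.assoc DD indicator_def)
  also have "\<dots> = g z"
    using sum_over_cells[OF assms(2,1)] by (simp add: scaleR_conv_of_real)
  finally show ?thesis .
qed

text \<open>
  Exchanging indices and points with \<open>psi_digit_commute\<close> turns the sum over the points into a
  sum over the characters, which is a Dirichlet kernel.
\<close>

lemma psi_orthonormal:
  assumes "i < M k" "i' < M k"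
  shows "(\<Sum>q<M k. \<psi> i (digit q) * cnj (\<psi> i' (digit q))) = (if i = i' then of_nat (M k) else 0)"
proof -
  have "(\<Sum>q<M k. \<psi> i (digit q) * cnj (\<psi> i' (digit q))) = dirichlet (M k) (digit i) (digit i')"
    unfolding dirichlet_def
    by (intro sum.cong refl arg_cong2[where f = "\<lambda>u v. u * cnj v"] psi_digit_commute)
      (use assms in auto)
  also have "\<dots> = (if i = i' then of_nat (M k) else 0)"
    using digits_inject[OF assms] by (subst dirichlet_M) (auto simp: digit_less)
  finally show ?thesis .
qed

lemma cell_const_rect_sum:
  assumes "a \<le> M k" "b \<le> M k"
  shows "cell_const k (rect_sum m c a b)"
  unfolding cell_const_def rect_sum_def
proof (intro ballI impI sum.cong refl)
  fix x y x' y' :: "nat \<Rightarrow> nat" and i j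
  assume "\<forall>l<k. x l = x' l \<and> y l = y' l" "i \<in> {..<a}" "j \<in> {..<b}"
  then have "\<psi> i x = \<psi> i x'" "\<psi> j y = \<psi> j y'"
    using assms by (auto intro!: psi_cong[of _ k])
  then show "c i j * \<psi> i (fst (x, y)) * \<psi> j (snd (x, y)) = c i j * \<psi> i (fst (x', y')) * \<psi> j (snd (x', y'))"
    by simp
qed

lemma fun_coeff_rect_sum:
  "vilenkin_fun_coeff m (rect_sum m c a b) i j = (if i < a \<and> j < b then c i j else 0)"
proof -
  obtain k where k: "i < M k" "j < M k" "a \<le> M k" "b \<le> M k"
    using less_M[of "i + j + a + b"] by (intro that[of "i + j + a + b"]) auto
  note cc = cell_const_rect_sum[OF k(3,4)]
  let ?d = "\<lambda>i i'. \<Sum>q<M k. \<psi> i' (digit q) * cnj (\<psi> i (digit q))"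
  have "(\<Sum>w\<in>idx k. rect_sum m c a b (rep w) * cnj (\<psi> i (fst (rep w))) * cnj (\<psi> j (snd (rep w)))) =
     (\<Sum>w\<in>idx k. \<Sum>i'<a. \<Sum>j'<b. c i' j' * ((\<psi> i' (digit (fst w)) * cnj (\<psi> i (digit (fst w)))) *
        (\<psi> j' (digit (snd w)) * cnj (\<psi> j (digit (snd w))))))"
    by (simp add: rect_sum_def rep_def sum_distrib_left sum_distrib_right mult_ac)
  also have "\<dots> = (\<Sum>i'<a. \<Sum>w\<in>idx k. \<Sum>j'<b. c i' j' * ((\<psi> i' (digit (fst w)) * cnj (\<psi> i (digit (fst w)))) *
        (\<psi> j' (digit (snd w)) * cnj (\<psi> j (digit (snd w))))))"
    by (rule sum.swap)
  also have "\<dots> = (\<Sum>i'<a. \<Sum>j'<b. \<Sum>w\<in>idx k. c i' j' * ((\<psi> i' (digit (fst w)) * cnj (\<psi> i (digit (fst w)))) *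
        (\<psi> j' (digit (snd w)) * cnj (\<psi> j (digit (snd w))))))"
    by (intro sum.cong refl) (rule sum.swap)
  also have "\<dots> = (\<Sum>i'<a. \<Sum>j'<b. c i' j' * (?d i i' * ?d j j'))"
    by (intro sum.cong refl, subst sum_product)
      (simp add: idx_def sum_distrib_left sum.cartesian_product case_prod_unfold)
  also have "\<dots> = (\<Sum>i'<a. \<Sum>j'<b. if i' = i then if j' = j then c i' j' * (of_nat (M k))\<^sup>2 else 0 else 0)"
  proof (intro sum.cong refl)
    fix i' j' assume "i' \<in> {..<a}" "j' \<in> {..<b}"
    then have "i' < M k" "j' < M k" using k by auto
    with k show "c i' j' * (?d i i' * ?d j j') =
        (if i' = i then if j' = j then c i' j' * (of_nat (M k))\<^sup>2 else 0 else 0)"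
      by (simp add: psi_orthonormal power2_eq_square)
  qed
  also have "\<dots> = (\<Sum>i'<a. if i' = i then if j < b then c i' j * (of_nat (M k))\<^sup>2 else 0 else 0)"
    by (intro sum.cong refl) (auto simp: sum.delta)
  also have "\<dots> = (if i < a \<and> j < b then c i j * (of_nat (M k))\<^sup>2 else 0)"
    by (auto simp: sum.delta)
  finally show ?thesis
    unfolding fun_coeff_cell_const[OF cc k(1,2)] by simp
qed

lemma rect_sum_truncated:
  "rect_sum m (\<lambda>i j. if i < a \<and> j < b then c i j else 0) a' b' = rect_sum m c (min a' a) (min b' b)"
proof
  fix z
  have "rect_sum m (\<lambda>i j. if i < a \<and> j < b then c i j else 0) a' b' z =
     (\<Sum>i\<in>{..<a'}. if i \<in> {..<a} then (\<Sum>j\<in>{..<b'}. if j \<in> {..<b} then c i j * \<psi> i (fst z) * \<psi> j (snd z) else 0) else 0)"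
    unfolding rect_sum_def by (intro sum.cong refl) (auto intro!: sum.cong)
  also have "\<dots> = (\<Sum>i\<in>{..<a'} \<inter> {..<a}. \<Sum>j\<in>{..<b'} \<inter> {..<b}. c i j * \<psi> i (fst z) * \<psi> j (snd z))"
    by (simp only: sum.inter_restrict [symmetric] finite_lessThan)
  also have "{..<a'} \<inter> {..<a} = {..<min a' a}" by auto
  also have "{..<b'} \<inter> {..<b} = {..<min b' b}" by auto
  finally show "rect_sum m (\<lambda>i j. if i < a \<and> j < b then c i j else 0) a' b' z =
      rect_sum m c (min a' a) (min b' b) z"
    by (simp add: rect_sum_def)
qed

lemma fun_martingale_rect_sum:
  "fun_martingale m (rect_sum m c a b) n = rect_sum m c (min (M n) a) (min (M n) b)"
  unfolding fun_martingale_def fun_coeff_rect_sum by (rule rect_sum_truncated)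

section \<open>Square martingales\<close>

lemma sets_square_filtration:
  "sets (square_filtration m k) = sigma_sets (G \<times> G) {cyl k x \<times> cyl k y | x y. x \<in> G \<and> y \<in> G}"
  unfolding square_filtration_def space_mu2
  by (rule sets_measure_of) (auto simp: vilenkin_cyl_def)

lemma space_square_filtration: "space (square_filtration m k) = G \<times> G"
  unfolding square_filtration_def space_mu2
  by (rule space_measure_of) (auto simp: vilenkin_cyl_def)

lemma cell_const_square_set:
  assumes "A \<in> sets (square_filtration m k)"
  shows "cell_const k (\<lambda>z. z \<in> A)"
  using assms unfolding sets_square_filtration
proof (induction rule: sigma_sets.induct)
  case (Basic A)
  then show ?case by (auto simp: cell_const_def vilenkin_cyl_def)
next
  case (Compl A)
  show ?case
    unfolding cell_const_def
  proof (intro ballI impI)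
    fix x y x' y'
    assume G: "x \<in> G" "y \<in> G" "x' \<in> G" "y' \<in> G" and eq: "\<forall>j<k. x j = x' j \<and> y j = y' j"
    then have "(x, y) \<in> A \<longleftrightarrow> (x', y') \<in> A"
      using Compl.IH unfolding cell_const_def by blast
    with G show "((x, y) \<in> G \<times> G - A) = ((x', y') \<in> G \<times> G - A)" by simp
  qed
next
  case (Union A)
  show ?case
    unfolding cell_const_def
  proof (intro ballI impI)
    fix x y x' y'
    assume G: "x \<in> G" "y \<in> G" "x' \<in> G" "y' \<in> G" and eq: "\<forall>j<k. x j = x' j \<and> y j = y' j"
    have "(x, y) \<in> A i \<longleftrightarrow> (x', y') \<in> A i" for i
      using Union.IH[of i] G eq unfolding cell_const_def by blast
    then show "((x, y) \<in> (\<Union>i. A i)) = ((x', y') \<in> (\<Union>i. A i))" by simp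
  qed
qed (simp add: cell_const_def)

text \<open>
  The preimage of a single value is a union of squares.
\<close>

lemma cell_const_of_measurable:
  fixes f :: vfun
  assumes "f \<in> borel_measurable (square_filtration m k)"
  shows "cell_const k f"
  unfolding cell_const_def
proof (intro ballI impI)
  fix x y x' y'
  assume G: "x \<in> G" "y \<in> G" "x' \<in> G" "y' \<in> G" and eq: "\<forall>j<k. x j = x' j \<and> y j = y' j"
  define A where "A = f -` {f (x, y)} \<inter> space (square_filtration m k)"
  have "A \<in> sets (square_filtration m k)"
    unfolding A_def using assms by (rule measurable_sets) simp
  from cell_const_square_set[OF this] G eq have "(x, y) \<in> A \<longleftrightarrow> (x', y') \<in> A"
    unfolding cell_const_def by blast
  with G show "f (x, y) = f (x', y')"
    by (simp add: A_def space_square_filtration)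
qed

lemma cell_in_square_filtration: "cell k w \<in> sets (square_filtration m k)"
  unfolding sets_square_filtration cell_def
  by (rule sigma_sets.Basic) (use digit_in_G in blast)

lemma cell_const_mono: "cell_const k g \<Longrightarrow> k \<le> n \<Longrightarrow> cell_const n g"
  unfolding cell_const_def by (meson order_less_le_trans)

lemma borel_measurable_cell_const:
  fixes g :: vfun
  assumes "cell_const k g"
  shows "g \<in> borel_measurable \<mu>2"
proof -
  have "(\<lambda>z. \<Sum>w\<in>idx k. indicator (cell k w) z *\<^sub>R g (rep w)) \<in> borel_measurable \<mu>2"
    by measurable
  then show ?thesis
    by (rule measurable_cong [THEN iffD1, rotated]) (rule sum_over_cells[OF _ assms])
qed

context
  fixes f :: "nat \<Rightarrow> vfun"
  assumes martingale: "square_martingale m f"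
begin

lemma martingale_cell_const: "cell_const k (f k)"
  using martingale by (intro cell_const_of_measurable) (simp add: square_martingale_def)

lemma martingale_measurable [measurable]: "f k \<in> borel_measurable \<mu>2"
  using martingale_cell_const by (rule borel_measurable_cell_const)

text \<open>
  The characters of index below \<open>M k\<close> are constant on the squares of level \<open>k\<close>, so the
  martingale property freezes the coefficient from step \<open>k\<close> on. The limit defining it is
  that of an eventually constant sequence.
\<close>

lemma martingale_coeff:
  assumes "i < M k" "j < M k"
  shows "vilenkin_coeff m f i j = vilenkin_fun_coeff m (f k) i j"
proof -
  have "vilenkin_fun_coeff m (f n) i j = vilenkin_fun_coeff m (f k) i j" if "k \<le> n" for n
  proof -
    have "(\<integral>z\<in>cell k w. f n z \<partial>\<mu>2) = (\<integral>z\<in>cell k w. f k z \<partial>\<mu>2)" for w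
      using martingale that cell_in_square_filtration[of k w] by (simp add: square_martingale_def)
    moreover have "integrable \<mu>2 (f l)" for l
      using martingale by (simp add: square_martingale_def)
    ultimately show ?thesis using assms by (simp add: fun_coeff_eq_sum_cells[of _ _ k])
  qed
  then have "eventually (\<lambda>n. vilenkin_fun_coeff m (f n) i j = vilenkin_fun_coeff m (f k) i j) sequentially"
    by (rule eventually_sequentiallyI)
  then show ?thesis
    unfolding vilenkin_coeff_def by (intro limI tendsto_eventually)
qed

lemma martingale_rect_sum:
  assumes "a \<le> M k" "b \<le> M k"
  shows "rect_sum m (vilenkin_coeff m f) a b = rect_sum m (vilenkin_fun_coeff m (f k)) a b"
  unfolding rect_sum_def fun_eq_iff using assms
  by (intro allI sum.cong refl) (simp add: martingale_coeff[of _ k])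

lemma martingale_eq_rect_sum:
  assumes "z \<in> space \<mu>2"
  shows "rect_sum m (vilenkin_coeff m f) (M k) (M k) z = f k z"
  using rect_sum_fun_coeff_M[OF martingale_cell_const assms] by (simp add: martingale_rect_sum[OF order_refl order_refl])

lemma fun_martingale_partial_sum:
  "fun_martingale m (partial_sum m a b f) n = rect_sum m (vilenkin_coeff m f) (min (M n) a) (min (M n) b)"
  unfolding partial_sum_def by (rule fun_martingale_rect_sum)

lemma fun_martingale_partial_sum_M:
  assumes "z \<in> space \<mu>2"
  shows "fun_martingale m (partial_sum m (M k) (M k) f) n z = f (min n k) z"
  unfolding fun_martingale_partial_sum M_min [symmetric] by (rule martingale_eq_rect_sum[OF assms])

text \<open>
  The martingale stopped at \<open>k\<close> is a polynomial of degree less than \<open>M k\<close> in each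
  variable, and such polynomials are reproduced by partial sums of orders \<open>a, b \<ge> M k\<close>.
  The left-hand side is therefore a partial sum of the increment \<open>f K - f k\<close> alone, whose size
  is measured by the modulus of continuity at \<open>1 / M k\<close>.
\<close>

lemma partial_sum_minus_martingale:
  assumes "M k \<le> a" "M k \<le> b" "a \<le> M K" "b \<le> M K" "k \<le> K" "z \<in> space \<mu>2"
  shows "fun_martingale m (partial_sum m a b f) n z - f (min n k) z =
    rect_sum m (vilenkin_fun_coeff m (\<lambda>z. f K z - f k z)) (min (M n) a) (min (M n) b) z"
proof -
  let ?c = "vilenkin_coeff m f"
  define a' b' where "a' = min (M n) a" and "b' = min (M n) b"
  have le: "a' \<le> M K" "b' \<le> M K" using assms by (auto simp: a'_def b'_def)
  have cK: "cell_const K (f K)" and ck: "cell_const K (f k)"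
    using martingale_cell_const cell_const_mono[OF _ assms(5)] by auto
  then have cd: "cell_const K (\<lambda>z. f K z - f k z)"
    by (rule cell_const_diff)
  have "vilenkin_fun_coeff m (f k) i j = vilenkin_fun_coeff m (rect_sum m ?c (M k) (M k)) i j" for i j
    unfolding vilenkin_fun_coeff_def
    by (intro Bochner_Integration.integral_cong refl) (simp add: martingale_eq_rect_sum)
  then have "vilenkin_fun_coeff m (f k) = (\<lambda>i j. if i < M k \<and> j < M k then ?c i j else 0)"
    by (simp add: fun_coeff_rect_sum fun_eq_iff)
  then have "rect_sum m (vilenkin_fun_coeff m (f k)) a' b' = rect_sum m ?c (min a' (M k)) (min b' (M k))"
    by (simp only: rect_sum_truncated)
  also have "min a' (M k) = M (min n k)"
    using assms by (simp add: a'_def M_min)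
  also have "min b' (M k) = M (min n k)"
    using assms by (simp add: b'_def M_min)
  finally have "rect_sum m (vilenkin_fun_coeff m (f k)) a' b' z = f (min n k) z"
    using martingale_eq_rect_sum[OF assms(6)] by simp
  moreover have "rect_sum m ?c a' b' z = rect_sum m (vilenkin_fun_coeff m (f K)) a' b' z"
    using martingale_rect_sum[OF le] by simp
  ultimately show ?thesis
    unfolding fun_martingale_partial_sum a'_def [symmetric] b'_def [symmetric]
    using rect_sum_fun_coeff[OF cK le] rect_sum_fun_coeff[OF ck le] rect_sum_fun_coeff[OF cd le]
    by (simp add: left_diff_distrib sum_subtractf diff_divide_distrib)
qed

end

section \<open>Integrals of powers of kernels\<close>

text \<open>
  At a point \<open>x\<close> whose first difference from \<open>t\<close> is in coordinate \<open>s < K\<close> the kernel is at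
  most \<open>M (s + 1) \<le> B * M s\<close>, which is the term \<open>s\<close> of the sum; if \<open>x\<close> and \<open>t\<close> agree
  up to level \<open>K\<close>, the trivial bound \<open>a \<le> M K\<close> is dominated by the last term. The
  right-hand side does not depend on \<open>a\<close>, so it also bounds the maximal kernel.
\<close>

lemma dirichlet_powr_le:
  assumes "\<And>k. m k \<le> B" "x \<in> G" "t \<in> G" "a \<le> M K" "0 < p"
  shows "cmod (dirichlet a x t) powr p \<le> (\<Sum>s\<le>K. (real B * real (M s)) powr p * indicator (cyl s t) x)"
proof -
  have G: "\<forall>j. x j < m j" "\<forall>j. t j < m j"
    using assms by (auto simp: space_vilenkin_measure)
  have "\<exists>s\<le>K. x \<in> cyl s t \<and> cmod (dirichlet a x t) \<le> real B * real (M s)"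
  proof (cases "\<forall>j<K. x j = t j")
    case True
    have "a \<le> B * M K"
      using assms(1)[of 0] m_pos[of 0] assms(4) by (metis le_trans mult_le_mono1 nat_mult_1 One_nat_def Suc_leI less_le_trans)
    then have "cmod (dirichlet a x t) \<le> real B * real (M K)"
      using norm_dirichlet_le[of a x t] by (metis of_nat_le_iff of_nat_mult order_trans)
    with True assms show ?thesis by (auto simp: vilenkin_cyl_def)
  next
    case False
    define s where "s = (LEAST j. x j \<noteq> t j)"
    obtain j where j: "j < K" "x j \<noteq> t j" using False by blast
    have s: "x s \<noteq> t s" "s < K" "\<forall>i<s. x i = t i"
      using LeastI[of "\<lambda>j. x j \<noteq> t j", OF j(2)] Least_le[of "\<lambda>j. x j \<noteq> t j", OF j(2)] j(1)
        not_less_Least[of _ "\<lambda>j. x j \<noteq> t j"]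
      by (auto simp flip: s_def)
    have "cmod (dirichlet a x t) \<le> real (M (Suc s))"
      using G s(1) by (intro norm_dirichlet_le_M) auto
    also have "\<dots> \<le> real B * real (M s)"
      using assms(1)[of s] by (simp add: M_Suc mult.commute mult_right_mono)
    finally show ?thesis using s assms by (auto simp: vilenkin_cyl_def intro!: exI[of _ s])
  qed
  then obtain s where s: "s \<le> K" "x \<in> cyl s t" "cmod (dirichlet a x t) \<le> real B * real (M s)" by blast
  have "cmod (dirichlet a x t) powr p \<le> (real B * real (M s)) powr p * indicator (cyl s t) x"
    using s assms by (simp add: powr_mono2)
  also have "\<dots> \<le> (\<Sum>s\<le>K. (real B * real (M s)) powr p * indicator (cyl s t) x)"
    using s by (intro member_le_sum[where f = "\<lambda>s. (real B * real (M s)) powr p * indicator (cyl s t) x"]) auto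
  finally show ?thesis .
qed

lemma M_powr_le:
  assumes "r \<le> 0"
  shows "real (M (k + i)) powr r \<le> real (M k) powr r * (2 powr r) ^ i"
proof -
  have "real (M (k + i)) powr r \<le> real (2 ^ i * M k) powr r"
    using assms M_growth[of i k] by (intro powr_mono2') (auto simp only: of_nat_le_iff of_nat_0_less_iff, auto)
  also have "\<dots> = real (M k) powr r * (2 powr r) ^ i"
    by (simp add: powr_mult powr_realpow [symmetric] powr_powr mult.commute)
  finally show ?thesis .
qed

text \<open>
  The cylinder of level \<open>s\<close> has measure \<open>1 / M s\<close>, so the integral is
  \<open>B\<^sup>p \<Sum>s\<le>K. (M s)\<^sup>p\<^sup>-\<^sup>1\<close>. For \<open>p < 1\<close> this is dominated by a geometric series,
  uniformly in \<open>K\<close>.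
\<close>

lemma nn_integral_kernel_bound:
  assumes "t \<in> G" "0 < p" "p < 1"
  shows "(\<integral>\<^sup>+ x. ennreal (\<Sum>s\<le>K. (real B * real (M s)) powr p * indicator (cyl s t) x) \<partial>\<mu>)
    \<le> ennreal (real B powr p / (1 - 2 powr (p - 1)))"
proof -
  have q: "0 \<le> (2::real) powr (p - 1)" "(2::real) powr (p - 1) < 1"
    using assms powr_less_mono[of "p - 1" 0 2] by auto
  have eq: "ennreal (\<Sum>s\<le>K. (real B * real (M s)) powr p * indicator (cyl s t) x) =
    (\<Sum>s\<le>K. ennreal ((real B * real (M s)) powr p) * indicator (cyl s t) x)" for x
    by (subst sum_ennreal [symmetric]) (auto intro!: sum.cong simp: indicator_def)
  have "(\<integral>\<^sup>+ x. ennreal (\<Sum>s\<le>K. (real B * real (M s)) powr p * indicator (cyl s t) x) \<partial>\<mu>) =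
    (\<Sum>s\<le>K. \<integral>\<^sup>+ x. ennreal ((real B * real (M s)) powr p) * indicator (cyl s t) x \<partial>\<mu>)"
    unfolding eq by (rule nn_integral_sum) (simp add: sets_cyl assms)
  also have "\<dots> = (\<Sum>s\<le>K. ennreal ((real B * real (M s)) powr p * (1 / real (M s))))"
    using assms by (intro sum.cong refl)
      (simp add: nn_integral_cmult_indicator sets_cyl emeasure_cyl flip: ennreal_mult)
  also have "\<dots> = ennreal (\<Sum>s\<le>K. (real B * real (M s)) powr p * (1 / real (M s)))"
    by (rule sum_ennreal) simp
  also have "(\<Sum>s\<le>K. (real B * real (M s)) powr p * (1 / real (M s))) = 
      real B powr p * (\<Sum>s\<le>K. real (M s) powr (p - 1))"
    by (simp add: sum_distrib_left powr_mult powr_diff)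
  also have "(\<Sum>s\<le>K. real (M s) powr (p - 1)) \<le> (\<Sum>s\<le>K. (2 powr (p - 1)) ^ s)"
    using M_powr_le[of "p - 1" 0] assms by (intro sum_mono) simp
  also have "\<dots> \<le> (\<Sum>s. (2 powr (p - 1)) ^ s)"
    using q by (intro sum_le_suminf summable_geometric) auto
  also have "\<dots> = 1 / (1 - 2 powr (p - 1))"
    using q by (intro suminf_geometric) simp
  finally show ?thesis by (simp add: mult_left_mono ennreal_leI)
qed

lemma nn_integral_mu2_product:
  assumes [measurable]: "u \<in> borel_measurable \<mu>" "v \<in> borel_measurable \<mu>"
  shows "(\<integral>\<^sup>+ z. u (fst z) * v (snd z) \<partial>\<mu>2) = (\<integral>\<^sup>+ x. u x \<partial>\<mu>) * (\<integral>\<^sup>+ y. v y \<partial>\<mu>)"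
proof -
  have "(\<integral>\<^sup>+ z. u (fst z) * v (snd z) \<partial>\<mu>2) = (\<integral>\<^sup>+ x. \<integral>\<^sup>+ y. u x * v y \<partial>\<mu> \<partial>\<mu>)"
    unfolding vilenkin_measure2_def by (subst mu.nn_integral_fst [symmetric]) simp_all
  then show ?thesis by (simp add: nn_integral_cmult nn_integral_multc)
qed

section \<open>Partial sums in the Hardy space\<close>

text \<open>
  The \<open>p\<close>-th power of the \<open>H\<^sub>p\<close> quasi-norm, which is subadditive for \<open>p < 1\<close>.
\<close>

definition Hp_pow :: "real \<Rightarrow> (nat \<Rightarrow> vfun) \<Rightarrow> ennreal" where
  "Hp_pow p h = (\<integral>\<^sup>+ z. ennreal_rpow (maximal_function h z) p \<partial>\<mu>2)"

lemma Hp_norm_eq: "Hp_norm m p h = ennreal_rpow (Hp_pow p h) (1 / p)"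
  by (simp add: Hp_norm_def Lp_norm_def Hp_pow_def)

lemma Hp_pow_eq: "0 < p \<Longrightarrow> Hp_pow p h = ennreal_rpow (Hp_norm m p h) p"
  by (simp add: Hp_norm_eq ennreal_rpow_rpow)

lemma Hp_norm_less_top_iff: "Hp_norm m p h < \<top> \<longleftrightarrow> Hp_pow p h < \<top>"
  by (auto simp: Hp_norm_eq ennreal_rpow_def less_top)

lemma Hp_pow_cong:
  assumes "\<And>n z. z \<in> space \<mu>2 \<Longrightarrow> g n z = h n z"
  shows "Hp_pow p g = Hp_pow p h"
  unfolding Hp_pow_def maximal_function_def using assms by (intro nn_integral_cong) simp

lemma Hp_pow_le:
  assumes "0 < p" "\<And>n z. z \<in> space \<mu>2 \<Longrightarrow> ennreal (cmod (h n z) powr p) \<le> X z"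
  shows "Hp_pow p h \<le> (\<integral>\<^sup>+ z. X z \<partial>\<mu>2)"
  unfolding Hp_pow_def using assms by (intro nn_integral_mono ennreal_rpow_maximal_le)

lemma Hp_pow_diff_le:
  assumes p: "0 < p" "p < 1"
    and [measurable]: "\<And>n. g n \<in> borel_measurable \<mu>2" "\<And>n. h n \<in> borel_measurable \<mu>2"
  shows "Hp_pow p (\<lambda>n z. g n z - h n z) \<le> Hp_pow p g + Hp_pow p h"
proof -
  let ?X = "\<lambda>h z. ennreal_rpow (maximal_function h z) p"
  have "Hp_pow p (\<lambda>n z. g n z - h n z) \<le> (\<integral>\<^sup>+ z. ?X g z + ?X h z \<partial>\<mu>2)"
  proof (rule Hp_pow_le[OF p(1)])
    fix n z
    have "cmod (g n z - h n z) powr p \<le> (cmod (g n z) + cmod (h n z)) powr p"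
      using p by (intro powr_mono2 norm_triangle_ineq4) auto
    also have "\<dots> \<le> cmod (g n z) powr p + cmod (h n z) powr p"
      using p by (intro powr_add_le) auto
    finally have "ennreal (cmod (g n z - h n z) powr p) \<le>
        ennreal (cmod (g n z) powr p) + ennreal (cmod (h n z) powr p)"
      by (simp add: ennreal_leI flip: ennreal_plus)
    also have "\<dots> \<le> ?X g z + ?X h z"
      using p by (intro add_mono le_ennreal_rpow_maximal)
    finally show "ennreal (cmod (g n z - h n z) powr p) \<le> ?X g z + ?X h z" .
  qed
  also have "\<dots> = Hp_pow p g + Hp_pow p h"
    unfolding Hp_pow_def maximal_function_def by (intro nn_integral_add) measurable
  finally show ?thesis .
qed

text \<open>
  The main estimate. By \<open>rect_sum_fun_coeff\<close> the partial sums of \<open>g\<close> are sums over the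
  squares of level \<open>K\<close> of \<open>g (rep w) / (M K)\<^sup>2\<close> times a product of two kernels. Subadditivity of
  the \<open>p\<close>-th power separates the squares, and each product of kernels has a bounded integral to
  the power \<open>p\<close>. What remains is \<open>(M K)\<^sup>-\<^sup>2\<^sup>p\<close> times the sum of
  \<open>\<bar>g (rep w)\<bar>\<^sup>p\<close>, which is \<open>(M K)\<^sup>2\<^sup>-\<^sup>2\<^sup>p\<close> times the integral of \<open>\<bar>g\<bar>\<^sup>p\<close>. The loss
  \<open>(M K)\<^sup>2\<^sup>-\<^sup>2\<^sup>p\<close> is the \<open>p\<close>-th power of the rate \<open>(M K)\<^sup>2\<^sup>/\<^sup>p\<^sup>-\<^sup>2\<close> in the theorem.
\<close>

lemma Hp_pow_rect_sum_le:
  assumes B: "\<And>k. m k \<le> B" and p: "0 < p" "p < 1"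
    and g: "cell_const K g" and le: "\<And>n. a n \<le> M K" "\<And>n. b n \<le> M K"
  shows "Hp_pow p (\<lambda>n. rect_sum m (vilenkin_fun_coeff m g) (a n) (b n)) \<le>
    ennreal ((real B powr p / (1 - 2 powr (p - 1)))\<^sup>2 * real (M K) powr (2 - 2 * p)) *
    (\<integral>\<^sup>+ z. ennreal (cmod (g z) powr p) \<partial>\<mu>2)"
proof -
  define C where "C = real B powr p / (1 - 2 powr (p - 1))"
  \<comment> \<open>A common bound for the \<open>p\<close>-th powers of all kernels \<open>D\<^sub>a(x - t)\<close> with \<open>a \<le> M K\<close>.\<close>
  define E where "E = (\<lambda>t x. \<Sum>s\<le>K. (real B * real (M s)) powr p * indicator (cyl s t) x)"
  define c where "c = (\<lambda>w. cmod (g (rep w)) powr p * (1 / (real (M K))\<^sup>2) powr p)"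
  have C: "0 \<le> C"
    using p powr_less_mono[of "p - 1" 0 2] by (simp add: C_def)
  have E: "0 \<le> E t x" for t x
    by (auto simp: E_def intro!: sum_nonneg)
  have c: "0 \<le> c w" for w by (simp add: c_def)
  have E_meas [measurable]: "E t \<in> borel_measurable \<mu>" if "t \<in> G" for t
    unfolding E_def using sets_cyl[OF that] by measurable
  define X where "X = (\<lambda>z. \<Sum>w\<in>idx K. ennreal (c w) * (ennreal (E (fst (rep w)) (fst z)) * ennreal (E (snd (rep w)) (snd z))))"
  have "Hp_pow p (\<lambda>n. rect_sum m (vilenkin_fun_coeff m g) (a n) (b n)) \<le> (\<integral>\<^sup>+ z. X z \<partial>\<mu>2)"
  proof (rule Hp_pow_le[OF p(1)])
    fix n z assume z: "z \<in> space \<mu>2"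
    let ?T = "\<lambda>w. cmod (g (rep w)) * cmod (dirichlet (a n) (fst z) (fst (rep w))) *
        cmod (dirichlet (b n) (snd z) (snd (rep w))) * (1 / (real (M K))\<^sup>2)"
    have "cmod (rect_sum m (vilenkin_fun_coeff m g) (a n) (b n) z) \<le> (\<Sum>w\<in>idx K. ?T w)"
      unfolding rect_sum_fun_coeff[OF g le(1) le(2)] sum_divide_distrib
      by (rule order_trans[OF norm_sum]) (simp add: norm_mult norm_divide norm_power)
    then have "cmod (rect_sum m (vilenkin_fun_coeff m g) (a n) (b n) z) powr p \<le> (\<Sum>w\<in>idx K. ?T w) powr p"
      using p by (intro powr_mono2) auto
    also have "\<dots> \<le> (\<Sum>w\<in>idx K. ?T w powr p)"
      using p by (intro powr_sum_le) auto
    also have "\<dots> \<le> (\<Sum>w\<in>idx K. c w * (E (fst (rep w)) (fst z) * E (snd (rep w)) (snd z)))"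
    proof (rule sum_mono)
      fix w
      have "cmod (dirichlet (a n) (fst z) (fst (rep w))) powr p \<le> E (fst (rep w)) (fst z)"
        unfolding E_def using z p le B by (intro dirichlet_powr_le) (auto simp: space_mu2 rep_def)
      moreover have "cmod (dirichlet (b n) (snd z) (snd (rep w))) powr p \<le> E (snd (rep w)) (snd z)"
        unfolding E_def using z p le B by (intro dirichlet_powr_le) (auto simp: space_mu2 rep_def)
      ultimately have "c w * (cmod (dirichlet (a n) (fst z) (fst (rep w))) powr p * cmod (dirichlet (b n) (snd z) (snd (rep w))) powr p)
         \<le> c w * (E (fst (rep w)) (fst z) * E (snd (rep w)) (snd z))"
        using E c by (intro mult_left_mono mult_mono) auto
      then show "?T w powr p \<le> c w * (E (fst (rep w)) (fst z) * E (snd (rep w)) (snd z))"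
        by (simp add: c_def powr_mult powr_divide mult_ac)
    qed
    finally show "ennreal (cmod (rect_sum m (vilenkin_fun_coeff m g) (a n) (b n) z) powr p) \<le> X z"
      unfolding X_def using E c by (simp add: ennreal_leI sum_nonneg flip: ennreal_mult)
  qed
  also have "(\<integral>\<^sup>+ z. X z \<partial>\<mu>2) = (\<Sum>w\<in>idx K. \<integral>\<^sup>+ z. ennreal (c w) * (ennreal (E (fst (rep w)) (fst z)) * ennreal (E (snd (rep w)) (snd z))) \<partial>\<mu>2)"
    unfolding X_def vilenkin_measure2_def using E_meas[OF digit_in_G]
    by (intro nn_integral_sum) (simp add: rep_def)
  also have "\<dots> = (\<Sum>w\<in>idx K. ennreal (c w) * ((\<integral>\<^sup>+ x. ennreal (E (fst (rep w)) x) \<partial>\<mu>) * (\<integral>\<^sup>+ y. ennreal (E (snd (rep w)) y) \<partial>\<mu>)))"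
  proof (intro sum.cong refl)
    fix w
    have [measurable]: "E (fst (rep w)) \<in> borel_measurable \<mu>" "E (snd (rep w)) \<in> borel_measurable \<mu>"
      using E_meas[OF digit_in_G] by (simp_all add: rep_def)
    show "(\<integral>\<^sup>+ z. ennreal (c w) * (ennreal (E (fst (rep w)) (fst z)) * ennreal (E (snd (rep w)) (snd z))) \<partial>\<mu>2) =
      ennreal (c w) * ((\<integral>\<^sup>+ x. ennreal (E (fst (rep w)) x) \<partial>\<mu>) * (\<integral>\<^sup>+ y. ennreal (E (snd (rep w)) y) \<partial>\<mu>))"
      by (subst nn_integral_mu2_product [symmetric])
        (auto simp: vilenkin_measure2_def intro!: nn_integral_cmult)
  qed
  also have "\<dots> \<le> (\<Sum>w\<in>idx K. ennreal (c w) * (ennreal C * ennreal C))"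
    unfolding E_def C_def rep_def fst_conv snd_conv
    by (intro sum_mono mult_left_mono mult_mono nn_integral_kernel_bound digit_in_G p) auto
  also have "\<dots> = ennreal (\<Sum>w\<in>idx K. c w * (C * C))"
    using C c by (simp flip: ennreal_mult sum_ennreal)
  also have "(\<Sum>w\<in>idx K. c w * (C * C)) =
      (C\<^sup>2 * real (M K) powr (2 - 2 * p)) * (\<Sum>w\<in>idx K. cmod (g (rep w)) powr p * (1 / (real (M K))\<^sup>2))"
  proof -
    have "(1 / (real (M K))\<^sup>2) powr p = real (M K) powr (2 - 2 * p) * (1 / (real (M K))\<^sup>2)"
      by (simp add: powr_divide powr_diff powr_powr flip: powr_numeral)
    then show ?thesis
      by (simp add: c_def sum_distrib_left power2_eq_square mult_ac)
  qed
  also have "ennreal \<dots> = ennreal (C\<^sup>2 * real (M K) powr (2 - 2 * p)) *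
      (\<integral>\<^sup>+ z. ennreal (cmod (g z) powr p) \<partial>\<mu>2)"
  proof -
    have "cell_const K (\<lambda>z. cmod (g z) powr p)"
      using g unfolding cell_const_def by (intro ballI impI arg_cong[where f = "\<lambda>u. cmod u powr p"]) blast
    from nn_integral_cell_const[OF this] show ?thesis
      by (simp add: ennreal_mult sum_nonneg flip: ennreal_mult)
  qed
  finally show ?thesis unfolding C_def .
qed

text \<open>
  The error is the partial sum of the increment \<open>f K - f k\<close> minus the martingale
  \<open>f n - f (min n k)\<close>, whose quasi-norm is the modulus of continuity. The increment is the value
  of the latter martingale at \<open>n = K\<close>, so its \<open>L\<^sub>p\<close> quasi-norm is bounded by the modulus too.
\<close>

lemma Hp_pow_partial_sum_diff_le:
  assumes B: "\<And>k. m k \<le> B" and p: "0 < p" "p < 1" and f: "square_martingale m f"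
    and ab: "M k \<le> a" "M k \<le> b" "a \<le> M K" "b \<le> M K" "k \<le> K"
  shows "Hp_pow p (\<lambda>n z. fun_martingale m (partial_sum m a b f) n z - f n z) \<le>
    ennreal ((real B powr p / (1 - 2 powr (p - 1)))\<^sup>2 * real (M K) powr (2 - 2 * p) + 1) *
    Hp_pow p (\<lambda>n z. f n z - fun_martingale m (partial_sum m (M k) (M k) f) n z)"
proof -
  let ?Q = "(real B powr p / (1 - 2 powr (p - 1)))\<^sup>2 * real (M K) powr (2 - 2 * p)"
  define h where "h = (\<lambda>z. f K z - f k z)"
  define g where "g = (\<lambda>n z. f n z - f (min n k) z)"
  define S where "S = (\<lambda>n. rect_sum m (vilenkin_fun_coeff m h) (min (M n) a) (min (M n) b))"
  note [measurable] = martingale_measurable[OF f]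
  have h: "cell_const K h"
    unfolding h_def using martingale_cell_const[OF f] ab(5)
    by (intro cell_const_diff) (auto intro: cell_const_mono)
  have [measurable]: "S n \<in> borel_measurable \<mu>2" for n
    unfolding S_def using ab by (intro borel_measurable_cell_const[OF cell_const_rect_sum[of _ K]]) auto
  have [measurable]: "g n \<in> borel_measurable \<mu>2" for n
    unfolding g_def by measurable
  have "Hp_pow p (\<lambda>n z. fun_martingale m (partial_sum m a b f) n z - f n z) = Hp_pow p (\<lambda>n z. S n z - g n z)"
  proof (rule Hp_pow_cong)
    fix n z assume "z \<in> space \<mu>2"
    from partial_sum_minus_martingale[OF f ab this, of n]
    show "fun_martingale m (partial_sum m a b f) n z - f n z = S n z - g n z"
      by (simp add: S_def g_def h_def algebra_simps)
  qed
  also have "\<dots> \<le> Hp_pow p S + Hp_pow p g"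
    using p by (intro Hp_pow_diff_le) measurable
  also have "Hp_pow p S \<le> ennreal ?Q * (\<integral>\<^sup>+ z. ennreal (cmod (h z) powr p) \<partial>\<mu>2)"
    unfolding S_def using ab by (intro Hp_pow_rect_sum_le B p h) auto
  also have "(\<integral>\<^sup>+ z. ennreal (cmod (h z) powr p) \<partial>\<mu>2) \<le> Hp_pow p g"
    unfolding Hp_pow_def
  proof (rule nn_integral_mono)
    fix z
    show "ennreal (cmod (h z) powr p) \<le> ennreal_rpow (maximal_function g z) p"
      using le_ennreal_rpow_maximal[OF p(1), of g K z] ab(5) by (simp add: h_def g_def)
  qed
  also have "ennreal ?Q * Hp_pow p g + Hp_pow p g = ennreal (?Q + 1) * Hp_pow p g"
    by (simp add: distrib_right)
  also have "Hp_pow p g = Hp_pow p (\<lambda>n z. f n z - fun_martingale m (partial_sum m (M k) (M k) f) n z)"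
    by (rule Hp_pow_cong) (simp add: g_def fun_martingale_partial_sum_M[OF f])
  finally show ?thesis by (simp add: add_mono mult_left_mono)
qed

text \<open>
  This makes \<open>enn2real\<close> of the modulus meaningful: \<open>enn2real \<top>\<close> would be 0.
\<close>

lemma Hp_modulus_finite:
  assumes "f \<in> Hp_square m p" "0 < p" "p < 1"
  shows "Hp_modulus m p f k < \<top>"
proof -
  have f: "square_martingale m f" "Hp_pow p f < \<top>"
    using assms by (auto simp: Hp_square_def Hp_norm_less_top_iff)
  note [measurable] = martingale_measurable[OF f(1)]
  have "Hp_pow p (\<lambda>n z. f n z - fun_martingale m (partial_sum m (M k) (M k) f) n z) =
      Hp_pow p (\<lambda>n z. f n z - f (min n k) z)"
    by (rule Hp_pow_cong) (simp add: fun_martingale_partial_sum_M[OF f(1)])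
  also have "\<dots> \<le> Hp_pow p f + Hp_pow p (\<lambda>n. f (min n k))"
    using assms by (intro Hp_pow_diff_le) measurable
  also have "Hp_pow p (\<lambda>n. f (min n k)) \<le> Hp_pow p f"
    unfolding Hp_pow_def[of p f] using assms by (intro Hp_pow_le le_ennreal_rpow_maximal)
  finally have "Hp_pow p (\<lambda>n z. f n z - fun_martingale m (partial_sum m (M k) (M k) f) n z) \<le>
      Hp_pow p f + Hp_pow p f" by simp
  also have "\<dots> < \<top>" using f(2) by simp
  finally show ?thesis unfolding Hp_modulus_def Hp_norm_less_top_iff .
qed

section \<open>Convergence in the cone\<close>

text \<open>
  For \<open>n > 0\<close> this is the largest \<open>k\<close> with \<open>M k \<le> n\<close>.
\<close>

definition level :: "nat \<Rightarrow> nat" where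
  "level n = (LEAST k. n < M (Suc k))"

lemma less_M_Suc_level: "n < M (Suc (level n))"
  unfolding level_def by (rule LeastI[of _ n]) (use less_M[of "Suc n"] in simp)

lemma M_level_le:
  assumes "0 < n"
  shows "M (level n) \<le> n"
proof (cases "level n")
  case (Suc l)
  then have "\<not> n < M (Suc l)"
    unfolding level_def by (metis lessI not_less_Least)
  then show ?thesis using Suc by simp
qed (use assms in simp)

lemma le_level:
  assumes "M j \<le> n"
  shows "j \<le> level n"
proof (rule ccontr)
  assume "\<not> j \<le> level n"
  then have "M (Suc (level n)) \<le> M j" by (intro M_mono) simp
  with less_M_Suc_level[of n] assms show False by simp
qed

text \<open>
  In the cone, \<open>min a b\<close> and \<open>max a b\<close> differ at most by the factor \<open>2\<^sup>\<alpha>\<close>. If \<open>M k\<close>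
  is the largest term of the sequence \<open>M\<close> not exceeding \<open>min a b\<close>, then \<open>max a b \<le> M (k + c)\<close> with \<open>c\<close>
  depending only on \<open>\<alpha>\<close> and \<open>B\<close>, and \<open>M (k + c) \<le> B\<^sup>c * M k\<close>. Hence the error is at
  most a constant times \<open>(M k)\<^sup>2\<^sup>/\<^sup>p\<^sup>-\<^sup>2\<close> times the modulus of continuity at \<open>1 / M k\<close>.
\<close>

lemma convergence_on_cone:
  assumes B: "\<And>k. m k \<le> B" and p: "0 < p" "p < 1" and "0 \<le> \<alpha>" and f: "f \<in> Hp_square m p"
    and small: "(\<lambda>k. enn2real (Hp_modulus m p f k)) \<in> o(\<lambda>k. 1 / real (M k) powr (2 / p - 2))"
  shows "((\<lambda>(a, b). Hp_norm m p (\<lambda>n z. fun_martingale m (partial_sum m a b f) n z - f n z))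
    \<longlongrightarrow> 0) (cone_filter \<alpha>)"
proof -
  define C where "C = (real B powr p / (1 - 2 powr (p - 1)))\<^sup>2"
  define w where "w = (\<lambda>k. enn2real (Hp_modulus m p f k))"
  obtain c :: nat where c: "2 powr \<alpha> * real B \<le> 2 ^ c"
    using real_arch_pow[of 2 "2 powr \<alpha> * real B"] by (auto intro: less_imp_le)
  define R where "R = (C * real (B ^ c) powr (2 - 2 * p) + 1) powr (1 / p)"
  define u where "u = (\<lambda>k. ennreal (R * (w k * real (M k) powr (2 / p - 2))))"
  have f': "square_martingale m f" using f by (simp add: Hp_square_def)
  have C: "0 \<le> C" by (simp add: C_def)
  have M_ge_1: "1 \<le> real (M k)" for k
    using M_mono[of 0 k] by simp
  have M_le: "M (k + i) \<le> B ^ i * M k" for k i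
  proof (induction i)
    case (Suc i)
    then have "M (k + i) * m (k + i) \<le> B ^ i * M k * B" by (intro mult_mono B) auto
    then show ?case by (simp add: M_Suc mult_ac)
  qed simp
  have bound: "Hp_norm m p (\<lambda>n z. fun_martingale m (partial_sum m a b f) n z - f n z) \<le> u (level (min a b))"
    if ab: "0 < a" "0 < b" and cone: "2 powr (- \<alpha>) \<le> real a / real b" "real a / real b \<le> 2 powr \<alpha>" for a b
  proof -
    define k where "k = level (min a b)"
    have k: "M k \<le> min a b" "min a b < M (Suc k)"
      using ab M_level_le[of "min a b"] less_M_Suc_level by (auto simp: k_def)
    have "real a \<le> 2 powr \<alpha> * real b"
      using cone(2) ab by (simp add: pos_divide_le_eq)
    moreover have "real b \<le> 2 powr \<alpha> * real a"
      using cone(1) ab by (simp add: powr_minus field_simps)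
    moreover have "1 \<le> 2 powr \<alpha>" using assms(4) by (simp add: ge_one_powr_ge_zero)
    ultimately have "real (max a b) \<le> 2 powr \<alpha> * real (min a b)"
      by (auto simp: max_def min_def)
    also have "\<dots> \<le> 2 powr \<alpha> * (real B * real (M k))"
    proof (rule mult_left_mono)
      have "min a b \<le> m k * M k"
        using k(2) by (simp add: M_Suc mult.commute)
      also have "\<dots> \<le> B * M k"
        by (rule mult_right_mono[OF B]) simp
      finally show "real (min a b) \<le> real B * real (M k)"
        by (simp only: of_nat_le_iff flip: of_nat_mult)
    qed simp
    also have "\<dots> \<le> 2 ^ c * real (M k)"
      using mult_right_mono[OF c, of "real (M k)"] by (simp add: mult_ac)
    also have "\<dots> \<le> real (M (k + c))"
      using of_nat_mono[OF M_growth[of c k], where ?'a = real] by simp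
    finally have K: "max a b \<le> M (k + c)" by (simp only: of_nat_le_iff)
    define Q where "Q = C * real (M (k + c)) powr (2 - 2 * p) + 1"
    have Q: "0 \<le> Q" using C by (simp add: Q_def)
    have "Hp_pow p (\<lambda>n z. fun_martingale m (partial_sum m a b f) n z - f n z) \<le>
      ennreal Q * Hp_pow p (\<lambda>n z. f n z - fun_martingale m (partial_sum m (M k) (M k) f) n z)"
      unfolding Q_def C_def using k K by (intro Hp_pow_partial_sum_diff_le B p f') auto
    also have "Hp_pow p (\<lambda>n z. f n z - fun_martingale m (partial_sum m (M k) (M k) f) n z) =
      ennreal_rpow (Hp_modulus m p f k) p"
      using p by (simp add: Hp_pow_eq Hp_modulus_def)
    also have "Hp_modulus m p f k = ennreal (w k)"
      using Hp_modulus_finite[OF f p] by (simp add: w_def)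
    also have "ennreal Q * ennreal_rpow (ennreal (w k)) p = ennreal (Q * w k powr p)"
      using Q by (simp add: ennreal_rpow_ennreal w_def ennreal_mult)
    finally have "Hp_norm m p (\<lambda>n z. fun_martingale m (partial_sum m a b f) n z - f n z) \<le>
        ennreal_rpow (ennreal (Q * w k powr p)) (1 / p)"
      unfolding Hp_norm_eq using p by (intro ennreal_rpow_mono) auto
    also have "\<dots> = ennreal (Q powr (1 / p) * w k)"
      using Q p by (simp add: ennreal_rpow_ennreal powr_mult powr_powr w_def)
    also have "\<dots> \<le> u k"
    proof -
      have "Q \<le> C * (real (B ^ c) * real (M k)) powr (2 - 2 * p) + real (M k) powr (2 - 2 * p)"
        unfolding Q_def using M_le[of k c] C p M_ge_1[of k]
        by (intro add_mono mult_left_mono powr_mono2 ge_one_powr_ge_zero)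
          (auto simp del: of_nat_mult of_nat_power simp: of_nat_le_iff simp flip: of_nat_mult)
      also have "\<dots> = (C * real (B ^ c) powr (2 - 2 * p) + 1) * real (M k) powr (2 - 2 * p)"
        by (simp add: powr_mult algebra_simps)
      finally have "Q powr (1 / p) \<le> ((C * real (B ^ c) powr (2 - 2 * p) + 1) * real (M k) powr (2 - 2 * p)) powr (1 / p)"
        using Q p by (intro powr_mono2) auto
      also have "\<dots> = R * real (M k) powr (2 / p - 2)"
        using C p by (simp add: R_def powr_mult powr_powr diff_divide_distrib)
      finally have "Q powr (1 / p) * w k \<le> R * real (M k) powr (2 / p - 2) * w k"
        by (intro mult_right_mono) (simp_all add: w_def)
      then show ?thesis unfolding u_def by (intro ennreal_leI) (simp add: mult_ac)
    qed
    finally show ?thesis unfolding k_def .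
  qed
  have "(\<lambda>k. w k / (1 / real (M k) powr (2 / p - 2))) \<longlonglongrightarrow> 0"
    using small unfolding w_def by (rule smalloD_tendsto)
  then have "(\<lambda>k. R * (w k * real (M k) powr (2 / p - 2))) \<longlonglongrightarrow> R * 0"
    by (intro tendsto_mult tendsto_const) simp
  then have u: "u \<longlonglongrightarrow> 0"
    unfolding u_def by (auto simp flip: ennreal_0 intro: tendsto_ennrealI)
  have "filterlim (\<lambda>(a, b). level (min a b)) sequentially (cone_filter \<alpha>)"
    unfolding filterlim_at_top
  proof
    fix j
    show "eventually (\<lambda>x. j \<le> (case x of (a, b) \<Rightarrow> level (min a b))) (cone_filter \<alpha>)"
      unfolding cone_filter_def eventually_inf_principal eventually_prod_sequentially
      by (rule exI[of _ "M j"]) (auto intro!: le_level)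
  qed
  then have lim: "((\<lambda>x. u (case x of (a, b) \<Rightarrow> level (min a b))) \<longlongrightarrow> 0) (cone_filter \<alpha>)"
    by (rule filterlim_compose[OF u])
  show ?thesis
  proof (rule tendsto_sandwich[OF _ _ tendsto_const lim])
    show "eventually (\<lambda>x. (case x of (a, b) \<Rightarrow> Hp_norm m p (\<lambda>n z. fun_martingale m (partial_sum m a b f) n z - f n z))
        \<le> u (case x of (a, b) \<Rightarrow> level (min a b))) (cone_filter \<alpha>)"
      unfolding cone_filter_def eventually_inf_principal eventually_prod_sequentially
      by (rule exI[of _ 1]) (auto intro!: bound)
  qed simp
qed

section \<open>Sharpness: the point mass at the identity\<close>

text \<open>
  The squares around the identity of \<open>G\<^sub>m\<^sup>2\<close>.
\<close>

definition corner :: "nat \<Rightarrow> ((nat \<Rightarrow> nat) \<times> (nat \<Rightarrow> nat)) set" where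
  "corner n = cyl n (\<lambda>_. 0) \<times> cyl n (\<lambda>_. 0)"

text \<open>
  The martingale of the unit point mass at the identity. All its Fourier coefficients are 1, and
  its pointwise limit is 0 everywhere else.
\<close>

definition delta :: "nat \<Rightarrow> vfun" where
  "delta n z = indicator (corner n) z *\<^sub>R (of_nat (M n))\<^sup>2"

lemma zero_in_G [simp]: "(\<lambda>_. 0) \<in> G"
  by (simp add: space_vilenkin_measure m_pos)

lemma psi_zero [simp]: "\<psi> i (\<lambda>_. 0) = 1"
  by (simp add: vilenkin_psi_def rademacher_def)

lemma sets_corner [measurable]: "corner n \<in> sets \<mu>2"
  by (simp add: corner_def sets_mu2 sets_cyl)

lemma emeasure_corner: "emeasure \<mu>2 (corner n) = ennreal (1 / (real (M n))\<^sup>2)"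
  by (simp add: corner_def emeasure_mu2_cyl_Times power2_eq_square)

lemma measure_corner: "measure \<mu>2 (corner n) = 1 / (real (M n))\<^sup>2"
  by (simp add: measure_def emeasure_corner)

lemma corner_antimono: "k \<le> n \<Longrightarrow> corner n \<subseteq> corner k"
  by (auto simp: corner_def vilenkin_cyl_def)

lemma integral_delta: "(\<integral>z. delta n z \<partial>\<mu>2) = 1"
  unfolding delta_def by (simp add: measure_corner scaleR_conv_of_real)

lemma integrable_delta: "integrable \<mu>2 (delta n)"
  unfolding delta_def by (intro integrable_indicator sets_corner) (simp add: emeasure_corner)

lemma square_martingale_delta: "square_martingale m delta"
  unfolding square_martingale_def
proof (intro conjI allI impI ballI)
  fix n
  have [measurable]: "corner n \<in> sets (square_filtration m n)"
    unfolding sets_square_filtration corner_def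
    by (rule sigma_sets.Basic) (use zero_in_G in blast)
  show "delta n \<in> borel_measurable (square_filtration m n)"
    unfolding delta_def by measurable
  show "integrable \<mu>2 (delta n)" by (rule integrable_delta)
next
  fix k n A
  assume "k \<le> n" and A: "A \<in> sets (square_filtration m k)"
  let ?o = "((\<lambda>_. 0), (\<lambda>_. 0)) :: (nat \<Rightarrow> nat) \<times> (nat \<Rightarrow> nat)"
  have "(\<integral>z\<in>A. delta l z \<partial>\<mu>2) = of_bool (?o \<in> A)" if "k \<le> l" for l
  proof -
    have A_iff: "z \<in> A \<longleftrightarrow> ?o \<in> A" if z: "z \<in> corner l" for z
    proof -
      obtain x y where xy: "z = (x, y)" by (cases z)
      have "x \<in> G" "y \<in> G" "\<forall>j<k. x j = 0 \<and> y j = 0"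
        using z \<open>k \<le> l\<close> by (auto simp: xy corner_def vilenkin_cyl_def)
      then show ?thesis
        using cell_const_square_set[OF A, unfolded cell_const_def, rule_format,
            of x y "\<lambda>_. 0" "\<lambda>_. 0"] by (simp add: xy)
    qed
    have "indicator A z *\<^sub>R delta l z = of_bool (?o \<in> A) * delta l z" for z
    proof (cases "z \<in> corner l")
      case True
      then show ?thesis using A_iff[OF True] by (simp add: indicator_def)
    qed (simp add: delta_def)
    then show ?thesis
      by (simp add: set_lebesgue_integral_def integral_delta)
  qed
  then show "(\<integral>z\<in>A. delta n z \<partial>\<mu>2) = (\<integral>z\<in>A. delta k z \<partial>\<mu>2)"
    using \<open>k \<le> n\<close> by simp
qed

lemma coeff_delta: "vilenkin_coeff m delta i j = 1"
proof -
  obtain k where k: "i < M k" "j < M k"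
    using less_M[of "i + j"] by (intro that[of "i + j"]) auto
  have eq: "delta k z * cnj (\<psi> i (fst z)) * cnj (\<psi> j (snd z)) = delta k z" for z
  proof (cases "z \<in> corner k")
    case True
    then have "\<psi> i (fst z) = 1" "\<psi> j (snd z) = 1"
      using psi_cong[OF k(1), of "fst z" "\<lambda>_. 0"] psi_cong[OF k(2), of "snd z" "\<lambda>_. 0"]
      by (auto simp: corner_def vilenkin_cyl_def)
    then show ?thesis by simp
  qed (simp add: delta_def)
  show ?thesis
    unfolding martingale_coeff[OF square_martingale_delta k] vilenkin_fun_coeff_def eq
    by (rule integral_delta)
qed

lemma partial_sum_delta: "partial_sum m a b delta z = dirichlet a (fst z) (\<lambda>_. 0) * dirichlet b (snd z) (\<lambda>_. 0)"
  by (simp add: partial_sum_def rect_sum_def coeff_delta dirichlet_def sum_product)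

text \<open>
  If \<open>z\<close> lies in a corner of level \<open>k + i\<close> whenever \<open>h n z\<close> is nonzero, and the value is
  then at most \<open>(M (k + i))\<^sup>2\<close>, the \<open>p\<close>-th power of the maximal function is dominated by the
  sum of \<open>(M (k + i))\<^sup>2\<^sup>p\<close> times the indicators of these corners. The integral of the sum is
  \<open>\<Sum>i. (M (k + i))\<^sup>2\<^sup>p\<^sup>-\<^sup>2\<close>, which for \<open>p < 1\<close> is comparable with its first term.
\<close>

lemma Hp_pow_spikes_le:
  assumes p: "0 < p" "p < 1"
    and h: "\<And>n z. z \<in> space \<mu>2 \<Longrightarrow> h n z = 0 \<or> (\<exists>i. z \<in> corner (k + i) \<and> cmod (h n z) \<le> (real (M (k + i)))\<^sup>2)"
  shows "Hp_pow p h \<le> ennreal (real (M k) powr (2 * p - 2) / (1 - 2 powr (2 * p - 2)))"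
proof -
  let ?t = "\<lambda>i z. ennreal (((real (M (k + i)))\<^sup>2) powr p) * indicator (corner (k + i)) z"
  have term_le_suminf: "v i \<le> (\<Sum>j. v j)" for v :: "nat \<Rightarrow> ennreal" and i
    using sum_le_suminf[of v "{i}"] by simp
  have q: "0 \<le> (2::real) powr (2 * p - 2)" "(2::real) powr (2 * p - 2) < 1"
    using p powr_less_mono[of "2 * p - 2" 0 2] by auto
  have "Hp_pow p h \<le> (\<integral>\<^sup>+ z. (\<Sum>i. ?t i z) \<partial>\<mu>2)"
  proof (rule Hp_pow_le[OF p(1)])
    fix n z assume "z \<in> space \<mu>2"
    from h[OF this, of n] show "ennreal (cmod (h n z) powr p) \<le> (\<Sum>i. ?t i z)"
    proof (elim disjE exE conjE)
      fix i assume i: "z \<in> corner (k + i)" "cmod (h n z) \<le> (real (M (k + i)))\<^sup>2"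
      then have "ennreal (cmod (h n z) powr p) \<le> ?t i z"
        using p by (simp add: ennreal_leI powr_mono2)
      also have "\<dots> \<le> (\<Sum>i. ?t i z)"
        by (rule term_le_suminf)
      finally show ?thesis .
    qed simp
  qed
  also have "\<dots> = (\<Sum>i. \<integral>\<^sup>+ z. ?t i z \<partial>\<mu>2)"
    by (rule nn_integral_suminf) simp
  also have "\<dots> = (\<Sum>i. ennreal (real (M (k + i)) powr (2 * p - 2)))"
    by (simp add: nn_integral_cmult_indicator emeasure_corner powr_diff powr_powr
        flip: ennreal_mult powr_numeral)
  also have "\<dots> \<le> (\<Sum>i. ennreal (real (M k) powr (2 * p - 2) * (2 powr (2 * p - 2)) ^ i))"
    using p by (intro suminf_le summableI ennreal_leI M_powr_le) simp
  also have "\<dots> = ennreal (real (M k) powr (2 * p - 2) * (1 / (1 - 2 powr (2 * p - 2))))"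
    using q by (intro suminf_ennreal_eq sums_mult geometric_sums) simp_all
  finally show ?thesis by simp
qed

lemma delta_in_Hp_square:
  assumes "0 < p" "p < 1"
  shows "delta \<in> Hp_square m p"
proof -
  have "Hp_pow p delta \<le> ennreal (real (M 0) powr (2 * p - 2) / (1 - 2 powr (2 * p - 2)))"
    using assms by (rule Hp_pow_spikes_le) (auto simp: delta_def indicator_def norm_power)
  also have "\<dots> < \<top>" by simp
  finally show ?thesis
    unfolding Hp_square_def mem_Collect_eq Hp_norm_less_top_iff using square_martingale_delta by blast
qed

text \<open>
  The difference \<open>delta n - delta (min n k)\<close> vanishes off the corner of level \<open>k\<close>. Inside that
  corner it is at most \<open>(M k)\<^sup>2\<close> or \<open>(M n)\<^sup>2\<close>, according to whether the point has left the
  corner of level \<open>n\<close>.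
\<close>

lemma Hp_modulus_delta_le:
  assumes p: "0 < p" "p < 1"
  shows "Hp_modulus m p delta k \<le>
    ennreal ((1 / (1 - 2 powr (2 * p - 2))) powr (1 / p) * (1 / real (M k) powr (2 / p - 2)))"
proof -
  have q: "(2::real) powr (2 * p - 2) < 1"
    using p powr_less_mono[of "2 * p - 2" 0 2] by auto
  have "Hp_pow p (\<lambda>n z. delta n z - fun_martingale m (partial_sum m (M k) (M k) delta) n z) =
      Hp_pow p (\<lambda>n z. delta n z - delta (min n k) z)"
    by (rule Hp_pow_cong) (simp add: fun_martingale_partial_sum_M[OF square_martingale_delta])
  also have "\<dots> \<le> ennreal (real (M k) powr (2 * p - 2) / (1 - 2 powr (2 * p - 2)))"
  proof (rule Hp_pow_spikes_le[OF p])
    fix n z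
    show "delta n z - delta (min n k) z = 0 \<or>
        (\<exists>i. z \<in> corner (k + i) \<and> cmod (delta n z - delta (min n k) z) \<le> (real (M (k + i)))\<^sup>2)"
    proof (cases "n \<le> k \<or> z \<notin> corner k")
      case True
      then show ?thesis
        using corner_antimono[of k n] by (auto simp: delta_def min_def indicator_def)
    next
      case False
      then have n: "k \<le> n" "z \<in> corner k" by auto
      show ?thesis
      proof (cases "z \<in> corner n")
        case True
        have "(real (M k))\<^sup>2 \<le> (real (M n))\<^sup>2"
          using M_mono[OF n(1)] by (intro power_mono) auto
        moreover have "delta n z - delta (min n k) z = of_real ((real (M n))\<^sup>2 - (real (M k))\<^sup>2)"
          using True n by (simp add: delta_def min_def)
        ultimately have "cmod (delta n z - delta (min n k) z) \<le> (real (M n))\<^sup>2"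
          by (simp only: norm_of_real) simp
        then show ?thesis using True n by (intro disjI2 exI[of _ "n - k"]) simp
      next
        case False
        then show ?thesis using n
          by (intro disjI2 exI[of _ 0]) (simp add: delta_def min_def norm_power)
      qed
    qed
  qed
  finally have "Hp_modulus m p delta k \<le>
      ennreal_rpow (ennreal (real (M k) powr (2 * p - 2) / (1 - 2 powr (2 * p - 2)))) (1 / p)"
    unfolding Hp_modulus_def Hp_norm_eq using p by (intro ennreal_rpow_mono) auto
  also have "\<dots> = ennreal ((real (M k) powr (2 * p - 2)) powr (1 / p) * (1 / (1 - 2 powr (2 * p - 2))) powr (1 / p))"
    using q by (simp add: ennreal_rpow_ennreal flip: powr_mult)
  also have "(real (M k) powr (2 * p - 2)) powr (1 / p) = 1 / real (M k) powr (2 / p - 2)"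
  proof -
    have "(2 * p - 2) * (1 / p) = - (2 / p - 2)"
      using p by (simp add: field_simps)
    then show ?thesis by (simp only: powr_powr powr_minus_divide)
  qed
  finally show ?thesis by (simp only: mult.commute)
qed

text \<open>
  Off the cylinder the kernel of order \<open>M N\<close> vanishes, and one single character is left.
\<close>

lemma cmod_dirichlet_M_plus_1:
  assumes "x \<in> G - cyl N (\<lambda>_. 0)"
  shows "cmod (dirichlet (M N + 1) x (\<lambda>_. 0)) = 1"
proof -
  have "dirichlet (M N) x (\<lambda>_. 0) = 0"
    using assms by (subst dirichlet_M) (auto simp: space_vilenkin_measure vilenkin_cyl_def m_pos)
  then show ?thesis by (simp add: dirichlet_def)
qed

lemma martingale_limit_delta:
  assumes "z \<notin> corner N"
  shows "martingale_limit delta z = 0"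
proof -
  have "delta n z = 0" if "N \<le> n" for n
    using assms corner_antimono[OF that] by (auto simp: delta_def indicator_def)
  then have "eventually (\<lambda>n. delta n z = 0) sequentially"
    by (rule eventually_sequentiallyI)
  then show ?thesis
    unfolding martingale_limit_def by (intro limI tendsto_eventually)
qed

text \<open>
  The partial sum of orders \<open>M N + 1\<close> has modulus 1 off a set whose measure is small for large
  \<open>N\<close>, while the limit of the martingale is 0 there. For \<open>N \<ge> 1\<close> the exceptional cylinder in
  each variable has measure at most \<open>1 / 2\<close>, so that at least measure \<open>1 / 4\<close> remains; the level
  \<open>1 / 2\<close> is one admissible choice below 1.
\<close>

lemma weak_norm_delta_ge:
  assumes p: "0 < p" and N: "1 \<le> N"
  shows "ennreal (1 / 2 * (1 / 4) powr (1 / p)) \<le>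
    weak_Lp_norm \<mu>2 p (\<lambda>z. partial_sum m (M N + 1) (M N + 1) delta z - martingale_limit delta z)"
proof -
  let ?h = "\<lambda>z. partial_sum m (M N + 1) (M N + 1) delta z - martingale_limit delta z"
  define U where "U = G - cyl N (\<lambda>_. 0)"
  have U: "U \<in> sets \<mu>" by (simp add: U_def sets_cyl sets.compl_sets)
  have [measurable]: "partial_sum m (M N + 1) (M N + 1) delta \<in> borel_measurable \<mu>2"
    unfolding partial_sum_def
    by (rule borel_measurable_cell_const[OF cell_const_rect_sum[of _ "M N + 1"]])
      (use less_M[of "M N + 1"] in auto)
  have [measurable]: "martingale_limit delta \<in> borel_measurable \<mu>2"
    unfolding martingale_limit_def
    using martingale_measurable[OF square_martingale_delta] by measurable
  have "real 2 \<le> real (M N)"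
    using M_mono[OF N] m_ge_2[of 0] M_Suc[of 0] by (intro of_nat_mono) simp
  then have "1 / 2 \<le> 1 - 1 / real (M N)" by (simp add: field_simps)
  also have "\<dots> = measure \<mu> U"
    unfolding U_def by (simp add: mu.prob_compl sets_cyl measure_cyl)
  finally have "ennreal (1 / 2 * (1 / 2)) \<le> ennreal (measure \<mu> U * measure \<mu> U)"
    by (intro ennreal_leI mult_mono) auto
  then have "ennreal (1 / 4) \<le> emeasure \<mu>2 (U \<times> U)"
    by (simp add: emeasure_mu2_Times U mu.emeasure_eq_measure ennreal_mult)
  also have "U \<times> U \<subseteq> {z \<in> space \<mu>2. cmod (?h z) > 1 / 2}"
  proof
    fix z assume "z \<in> U \<times> U"
    then obtain x y where z: "z = (x, y)" "x \<in> U" "y \<in> U" by blast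
    then have "z \<notin> corner N" by (simp add: U_def corner_def)
    moreover have "cmod (partial_sum m (M N + 1) (M N + 1) delta z) = 1"
      using z(2,3) cmod_dirichlet_M_plus_1 unfolding partial_sum_delta U_def z(1) norm_mult by simp
    ultimately show "z \<in> {z \<in> space \<mu>2. cmod (?h z) > 1 / 2}"
      using z by (simp add: martingale_limit_delta space_mu2 U_def)
  qed
  then have "emeasure \<mu>2 (U \<times> U) \<le> emeasure \<mu>2 {z \<in> space \<mu>2. cmod (?h z) > 1 / 2}"
    by (rule emeasure_mono) measurable
  finally have "ennreal_rpow (ennreal (1 / 4)) (1 / p) \<le>
      ennreal_rpow (emeasure \<mu>2 {z \<in> space \<mu>2. cmod (?h z) > 1 / 2}) (1 / p)"
    using p by (intro ennreal_rpow_mono) auto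
  then have "ennreal (1 / 2) * ennreal_rpow (ennreal (1 / 4)) (1 / p) \<le>
      ennreal (1 / 2) * ennreal_rpow (emeasure \<mu>2 {z \<in> space \<mu>2. cmod (?h z) > 1 / 2}) (1 / p)"
    by (rule mult_left_mono) simp
  also have "\<dots> \<le> weak_Lp_norm \<mu>2 p ?h"
    unfolding weak_Lp_norm_def by (rule SUP_upper) simp
  finally have "ennreal (1 / 2) * ennreal_rpow (ennreal (1 / 4)) (1 / p) \<le> weak_Lp_norm \<mu>2 p ?h" .
  also have "ennreal (1 / 2) * ennreal_rpow (ennreal (1 / 4)) (1 / p) =
      ennreal (1 / 2 * (1 / 4) powr (1 / p))"
    by (subst ennreal_rpow_ennreal, simp, rule ennreal_mult [symmetric]) simp_all
  finally show ?thesis .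
qed

text \<open>
  The offending partial sums are square, hence in the cone for every \<open>\<alpha> \<ge> 0\<close>.
\<close>

lemma weak_norm_delta_not_tendsto:
  assumes "0 < p" "0 \<le> \<alpha>"
  shows "\<not> ((\<lambda>(a, b). weak_Lp_norm \<mu>2 p (\<lambda>z. partial_sum m a b delta z - martingale_limit delta z))
    \<longlongrightarrow> 0) (cone_filter \<alpha>)"
proof
  let ?w = "\<lambda>a b. weak_Lp_norm \<mu>2 p (\<lambda>z. partial_sum m a b delta z - martingale_limit delta z)"
  define \<epsilon> where "\<epsilon> = ennreal (1 / 2 * (1 / 4) powr (1 / p))"
  assume "((\<lambda>(a, b). ?w a b) \<longlongrightarrow> 0) (cone_filter \<alpha>)"
  moreover have "0 < \<epsilon>" by (simp add: \<epsilon>_def)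
  ultimately have "eventually (\<lambda>x. (case x of (a, b) \<Rightarrow> ?w a b) < \<epsilon>) (cone_filter \<alpha>)"
    by (rule order_tendstoD)
  then obtain N where N: "\<And>a b. N \<le> a \<Longrightarrow> N \<le> b \<Longrightarrow>
      2 powr (- \<alpha>) \<le> real a / real b \<Longrightarrow> real a / real b \<le> 2 powr \<alpha> \<Longrightarrow> ?w a b < \<epsilon>"
    unfolding cone_filter_def eventually_inf_principal eventually_prod_sequentially by auto
  define a where "a = M (N + 1) + 1"
  have a: "N \<le> a" "0 < a" using less_M[of "N + 1"] by (simp_all add: a_def)
  have "2 powr (- \<alpha>) \<le> (1::real)" "(1::real) \<le> 2 powr \<alpha>"
    using assms(2) powr_mono[of "- \<alpha>" 0 2] by (auto simp: ge_one_powr_ge_zero)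
  with a N[of a a] have "?w a a < \<epsilon>" by simp
  moreover have "\<epsilon> \<le> ?w a a"
    unfolding \<epsilon>_def a_def using assms by (intro weak_norm_delta_ge) auto
  ultimately show False by simp
qed

end

section \<open>The critical rate of the modulus of continuity\<close>

theorem theorem3:
  fixes m :: "nat \<Rightarrow> nat" and p \<alpha> :: real
  assumes "\<And>k. m k \<ge> 2" and "bdd_above (range m)"
    and "0 < p" "p < 1" and "\<alpha> \<ge> 0"
  shows "(\<forall>f \<in> Hp_square m p.
            (\<lambda>k. enn2real (Hp_modulus m p f k)) \<in> o(\<lambda>k. 1 / real (vilenkin_M m k) powr (2 / p - 2)) \<longrightarrow>
            ((\<lambda>(a, b). Hp_norm m p (\<lambda>n z. fun_martingale m (partial_sum m a b f) n z - f n z))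
               \<longlongrightarrow> 0) (cone_filter \<alpha>))
       \<and> (\<exists>f \<in> Hp_square m p.
            (\<forall>k. Hp_modulus m p f k < \<top>) \<and>
            (\<lambda>k. enn2real (Hp_modulus m p f k)) \<in> O(\<lambda>k. 1 / real (vilenkin_M m k) powr (2 / p - 2)) \<and>
            \<not> ((\<lambda>(a, b). weak_Lp_norm (vilenkin_measure2 m) p
                   (\<lambda>z. partial_sum m a b f z - martingale_limit f z))
                 \<longlongrightarrow> 0) (cone_filter \<alpha>))"
proof -
  interpret vilenkin m by unfold_locales (rule assms(1))
  note p = assms(3,4)
  obtain B where B: "m k \<le> B" for k
    using assms(2) by (auto simp: bdd_above_def)
  define c where "c = (1 / (1 - 2 powr (2 * p - 2))) powr (1 / p)"
  have le: "enn2real (Hp_modulus m p delta k) \<le> c * (1 / real (M k) powr (2 / p - 2))" for k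
    using Hp_modulus_delta_le[OF p, of k] unfolding c_def
    by (intro enn2real_leI) auto
  have "(\<lambda>k. enn2real (Hp_modulus m p delta k)) \<in> O(\<lambda>k. 1 / real (M k) powr (2 / p - 2))"
    by (rule bigoI[of _ c]) (use le in auto)
  then show ?thesis
    using convergence_on_cone[OF B p assms(5)] delta_in_Hp_square[OF p]
      Hp_modulus_finite[OF delta_in_Hp_square[OF p] p] weak_norm_delta_not_tendsto[OF p(1) assms(5)]
    by blast
qed

end
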